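(* Consider a function $h:\mathbb{R}^m\to\overline{\mathbb{R}}$ and a map $c:\mathbb{R}^n\to\mathbb{R}^m$. Suppose that the sequence $\big(x_k,h(c(x_k))\big)$ generated by Algorithm ProxDescent (described in the context) has an accumulation point at $\big(\bar x,h(\bar c)\big)$, where $\bar c:=c(\bar x)$. Suppose that $c$ is $\mathcal{C}^2$ near $\bar x$, that $h$ is subdifferentially regular (thus lower semicontinuous) at $\bar c$ and is prox-bounded, and that the transversality condition $$\partial^\infty h(\bar c)\cap\mathrm{Null}\big(\nabla c(\bar x)^*\big)=\{0\}$$ holds. Then the criticality condition is satisfied at $\bar x$: there exists a vector $\bar v\in\partial h(\bar c)\cap\mathrm{Null}\big(\nabla c(\bar x)^*\big)$.
   Context: $\overline{\mathbb{R}}=[-\infty,+\infty]$; $|\cdot|$ is the Euclidean norm; $B_\epsilon(x)$ is the closed Euclidean ball of radius $\epsilon$ around $x$; the map $c$ is smooth, $\nabla c(x):\mathbb{R}^n\to\mathbb{R}^m$ is its derivative at $x$, $^*$ denotes the adjoint, $\mathrm{Null}$ the null space. Proximal linearized objective: $h_{x,\mu}(d):=h\big(c(x)+\nabla c(x)d\big)+\frac{\mu}{2}|d|^2$ for $d\in\mathbb{R}^n$. $h$ is prox-bounded here means: there are scalars $h_0$ and $q_0\ge0$ with $h(c)\ge h_0-q_0|c|^2$ for all $c\in\mathbb{R}^m$. Epigraph: $\mathrm{epi}\,h=\{(c,r)\in\mathbb{R}^m\times\mathbb{R}:r\ge h(c)\}$. For a locally closed set $S$ and $s\in S$, the normal cone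 $N_S(s)$ (set of normal vectors) consists of all limits of sequences $\lambda_k(u_k-v_k)$ where $\lambda_k>0$, $u_k\to s$, $v_k\to s$, and $v_k$ is a closest point to $u_k$ in $S$; tangent vectors to $S$ at $s$ are limits of sequences $\lambda_k(u_k-s)$ with $u_k\in S$, $u_k\to s$, $\lambda_k>0$. $S$ is Clarke regular at $s$ if the inner product of any normal vector with any tangent vector is nonpositive. At a point $\bar c$ where $h$ is finite and near which $h$ is lower semicontinuous, $\partial h(\bar c)=\{v:(v,-1)\in N_{\mathrm{epi}\,h}(\bar c,h(\bar c))\}$ and $\partial^\infty h(\bar c)=\{v:(v,0)\in N_{\mathrm{epi}\,h}(\bar c,h(\bar c))\}$, and $h$ is subdifferentially regular at $\bar c$ if $h$ is finite at $\bar c$, lower semicontinuous near $\bar c$, and $\mathrm{epi}\,h$ is Clarke regular at $(\bar c,h(\bar c))$. Algorithm ProxDescent. Fix constants $\tau>1$, $\sigma\in(0,1)$, $\mu_{\min}>0$. Choose $x_0\in\mathbb{R}^n$ with $h(c(x_0))$ finite and $\mu_0\ge\mu_{\min}$; set $\mu\leftarrow\mu_0$. For $k=0,1,2,\dots$ repeat the following inner iteration until a step is accepted: (1) If $d=0$ is a local minimizer of $h_{x_k,\mu}$, terminate with $\bar x=x_k$. (2) Find a local minimizer $d$ of $h_{x_k,\mu}$ such that $h_{x_k,\mu}(d)<h_{x_k,\mu}(0)$. If no such $d$ exists, set $\mu\leftarrow\tau\mu$ and repeat the inner iteration. (3) Otherwise derive a point $x^+$ from $x_k+d$ (by an efficient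 projection and/or other enhancements). If $$h(c(x_k))-h(c(x^+))\ge\sigma\big[h(c(x_k))-h(c(x_k)+\nabla c(x_k)d)\big]\quad\text{and}\quad|x^+-(x_k+d)|\le\tfrac12|d|,$$ then accept: set $x_{k+1}\leftarrow x^+$, $d_k\leftarrow d$, $\mu_k\leftarrow\mu$, and $\mu\leftarrow\max(\mu_{\min},\mu/\tau)$. Otherwise set $\mu\leftarrow\tau\mu$ and repeat the inner iteration. Standing assumption on the choice of $x^+$: the efficient projection is used whenever possible. That is, for each point $\bar x$ such that $c$ is $\mathcal{C}^2$ around $\bar x$, $h$ is lower semicontinuous and finite at $\bar c=c(\bar x)$, and $\partial^\infty h(\bar c)\cap\mathrm{Null}(\nabla c(\bar x)^* )=\{0\}$, there are constants $\gamma,\delta>0$ such that whenever $x_k\in B_\delta(\bar x)$, $d\in B_\delta(0)$ and $|h(c(x_k)+\nabla c(x_k)d)-h(\bar c)|<\delta$, the point $x^+$ chosen in step (3) satisfies $|x^+-(x_k+d)|\le\gamma|d|^2$ and $h(c(x^+))\le h(c(x_k)+\nabla c(x_k)d)+\gamma|d|^2$. *)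

theory Defs
  imports "HOL-Analysis.Analysis"
begin

section \<open>Variational analysis\<close>

definition C1_on :: "'a::real_normed_vector set \<Rightarrow> ('a \<Rightarrow> 'b::real_normed_vector) \<Rightarrow> bool" where
  "C1_on U f \<longleftrightarrow>
    (\<exists>f'. (\<forall>x\<in>U. (f has_derivative blinfun_apply (f' x)) (at x)) \<and> continuous_on U f')"

definition C2_on :: "'a::real_normed_vector set \<Rightarrow> ('a \<Rightarrow> 'b::real_normed_vector) \<Rightarrow> bool" where
  "C2_on U f \<longleftrightarrow>
    (\<exists>f'. (\<forall>x\<in>U. (f has_derivative blinfun_apply (f' x)) (at x)) \<and> C1_on U f')"

definition C2_near :: "('a::real_normed_vector \<Rightarrow> 'b::real_normed_vector) \<Rightarrow> 'a \<Rightarrow> bool" where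
  "C2_near f x \<longleftrightarrow> (\<exists>U. open U \<and> x \<in> U \<and> C2_on U f)"

definition lsc_near :: "('a::topological_space \<Rightarrow> ereal) \<Rightarrow> 'a \<Rightarrow> bool" where
  "lsc_near h x \<longleftrightarrow> (\<forall>\<^sub>F y in nhds x. h y \<le> Liminf (at y) h)"

definition local_minimizer :: "('a::topological_space \<Rightarrow> ereal) \<Rightarrow> 'a \<Rightarrow> bool" where
  "local_minimizer f x \<longleftrightarrow> (\<forall>\<^sub>F y in nhds x. f x \<le> f y)"

definition prox_bounded :: "('a::real_normed_vector \<Rightarrow> ereal) \<Rightarrow> bool" where
  "prox_bounded h \<longleftrightarrow> (\<exists>h0 q0. q0 \<ge> 0 \<and> (\<forall>y. h y \<ge> ereal (h0 - q0 * (norm y)\<^sup>2)))"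

definition epi :: "('a \<Rightarrow> ereal) \<Rightarrow> ('a \<times> real) set" where
  "epi h = {(y, r). h y \<le> ereal r}"

text \<open>The next two definitions are meant for \<open>s \<in> S\<close> with \<open>S\<close> locally closed.\<close>

definition normal_cone :: "'a::euclidean_space set \<Rightarrow> 'a \<Rightarrow> 'a set" where
  "normal_cone S s =
    {w. \<exists>(l :: nat \<Rightarrow> real) u v.
        (\<forall>k. l k > 0 \<and> v k \<in> S \<and> (\<forall>z\<in>S. dist (u k) (v k) \<le> dist (u k) z)) \<and>
        u \<longlonglongrightarrow> s \<and> v \<longlonglongrightarrow> s \<and> (\<lambda>k. l k *\<^sub>R (u k - v k)) \<longlonglongrightarrow> w}"

definition tangent_cone :: "'a::euclidean_space set \<Rightarrow> 'a \<Rightarrow> 'a set" where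
  "tangent_cone S s =
    {t. \<exists>(l :: nat \<Rightarrow> real) u.
        (\<forall>k. l k > 0 \<and> u k \<in> S) \<and> u \<longlonglongrightarrow> s \<and> (\<lambda>k. l k *\<^sub>R (u k - s)) \<longlonglongrightarrow> t}"

definition Clarke_regular :: "'a::euclidean_space set \<Rightarrow> 'a \<Rightarrow> bool" where
  "Clarke_regular S s \<longleftrightarrow> (\<forall>w\<in>normal_cone S s. \<forall>t\<in>tangent_cone S s. w \<bullet> t \<le> 0)"

text \<open>Since \<open>real_of_ereal\<close> sends infinite values to \<open>0\<close>, the two subdifferentials are
  meaningful only at points where \<open>h\<close> is finite (and near which it is lower semicontinuous).\<close>

definition subdiff :: "('a::euclidean_space \<Rightarrow> ereal) \<Rightarrow> 'a \<Rightarrow> 'a set" where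
  "subdiff h y = {v. (v, -1) \<in> normal_cone (epi h) (y, real_of_ereal (h y))}"

definition horizon_subdiff :: "('a::euclidean_space \<Rightarrow> ereal) \<Rightarrow> 'a \<Rightarrow> 'a set" where
  "horizon_subdiff h y = {v. (v, 0) \<in> normal_cone (epi h) (y, real_of_ereal (h y))}"

definition subdiff_regular :: "('a::euclidean_space \<Rightarrow> ereal) \<Rightarrow> 'a \<Rightarrow> bool" where
  "subdiff_regular h y \<longleftrightarrow>
    \<bar>h y\<bar> \<noteq> \<infinity> \<and> lsc_near h y \<and> Clarke_regular (epi h) (y, real_of_ereal (h y))"

definition null_adjoint_deriv :: "('a::euclidean_space \<Rightarrow> 'b::euclidean_space) \<Rightarrow> 'a \<Rightarrow> 'b set" where
  "null_adjoint_deriv c x = {v. adjoint (frechet_derivative c (at x)) v = 0}"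

definition transversal :: "('b::euclidean_space \<Rightarrow> ereal) \<Rightarrow> ('a::euclidean_space \<Rightarrow> 'b) \<Rightarrow> 'a \<Rightarrow> bool" where
  "transversal h c x \<longleftrightarrow> horizon_subdiff h (c x) \<inter> null_adjoint_deriv c x = {0}"

section \<open>Algorithm ProxDescent\<close>

definition linearization :: "('a::real_normed_vector \<Rightarrow> 'b::real_normed_vector) \<Rightarrow> 'a \<Rightarrow> 'a \<Rightarrow> 'b" where
  "linearization c x d = c x + frechet_derivative c (at x) d"

definition prox_lin ::
  "('b::real_normed_vector \<Rightarrow> ereal) \<Rightarrow> ('a::real_normed_vector \<Rightarrow> 'b) \<Rightarrow> 'a \<Rightarrow> real \<Rightarrow> 'a \<Rightarrow> ereal" where
  "prox_lin h c x \<mu> d = h (linearization c x d) + ereal (\<mu> / 2 * (norm d)\<^sup>2)"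

definition prox_step ::
  "('b::real_normed_vector \<Rightarrow> ereal) \<Rightarrow> ('a::real_normed_vector \<Rightarrow> 'b) \<Rightarrow> 'a \<Rightarrow> real \<Rightarrow> 'a \<Rightarrow> bool" where
  "prox_step h c x \<mu> d \<longleftrightarrow>
    local_minimizer (prox_lin h c x \<mu>) d \<and> prox_lin h c x \<mu> d < prox_lin h c x \<mu> 0"

definition acceptable ::
  "('b::real_normed_vector \<Rightarrow> ereal) \<Rightarrow> ('a::real_normed_vector \<Rightarrow> 'b) \<Rightarrow> real \<Rightarrow> 'a \<Rightarrow> 'a \<Rightarrow> 'a \<Rightarrow> bool" where
  "acceptable h c \<sigma> x d xplus \<longleftrightarrow>
    h (c x) - h (c xplus) \<ge> ereal \<sigma> * (h (c x) - h (linearization c x d)) \<and>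
    norm (xplus - (x + d)) \<le> 1 / 2 * norm d"

text \<open>An infinite run of the algorithm. Outer iteration \<open>k\<close>, at the point \<open>x k\<close>, consists of the
  inner iterations \<open>0, \<dots>, J k\<close>; the last one, and only that one, accepts its step. Inner iteration
  \<open>i\<close> uses the parameter \<open>\<mu> k i\<close>, and, whenever some \<open>d\<close> as required by step (2) exists, \<open>d k i\<close>
  is the one found and \<open>p k i\<close> is the point derived from \<open>x k + d k i\<close> in step (3); otherwise,
  and for \<open>i > J k\<close>, the values \<open>d k i\<close> and \<open>p k i\<close> are irrelevant. In the paper's notation,
  \<open>d\<^sub>k\<close> and \<open>\<mu>\<^sub>k\<close> are \<open>d k (J k)\<close> and \<open>\<mu> k (J k)\<close>, while the initial \<open>\<mu>\<^sub>0\<close> is \<open>\<mu> 0 0\<close>.\<close>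

definition ProxDescent_run ::
  "('b::real_normed_vector \<Rightarrow> ereal) \<Rightarrow> ('a::real_normed_vector \<Rightarrow> 'b) \<Rightarrow> real \<Rightarrow> real \<Rightarrow> real \<Rightarrow>
   (nat \<Rightarrow> 'a) \<Rightarrow> (nat \<Rightarrow> nat) \<Rightarrow> (nat \<Rightarrow> nat \<Rightarrow> real) \<Rightarrow> (nat \<Rightarrow> nat \<Rightarrow> 'a) \<Rightarrow> (nat \<Rightarrow> nat \<Rightarrow> 'a) \<Rightarrow> bool" where
  "ProxDescent_run h c \<tau> \<sigma> \<mu>min x J \<mu> d p \<longleftrightarrow>
    \<bar>h (c (x 0))\<bar> \<noteq> \<infinity> \<and> \<mu> 0 0 \<ge> \<mu>min \<and>
    (\<forall>k.
      (\<forall>i\<le>J k. \<not> local_minimizer (prox_lin h c (x k) (\<mu> k i)) 0) \<and>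
      (\<forall>i<J k.
        ((\<nexists>d'. prox_step h c (x k) (\<mu> k i) d') \<or>
         (prox_step h c (x k) (\<mu> k i) (d k i) \<and> \<not> acceptable h c \<sigma> (x k) (d k i) (p k i))) \<and>
        \<mu> k (Suc i) = \<tau> * \<mu> k i) \<and>
      prox_step h c (x k) (\<mu> k (J k)) (d k (J k)) \<and>
      acceptable h c \<sigma> (x k) (d k (J k)) (p k (J k)) \<and>
      x (Suc k) = p k (J k) \<and>
      \<mu> (Suc k) 0 = max \<mu>min (\<mu> k (J k) / \<tau>))"

text \<open>The efficient projection is used whenever possible. The requirement concerns every point
  derived in step (3), whether accepted or not; the \<open>prox_step\<close> premise singles out the inner
  iterations that reach step (3).\<close>

definition efficient_projection ::
  "('b::euclidean_space \<Rightarrow> ereal) \<Rightarrow> ('a::euclidean_space \<Rightarrow> 'b) \<Rightarrow>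
   (nat \<Rightarrow> 'a) \<Rightarrow> (nat \<Rightarrow> nat) \<Rightarrow> (nat \<Rightarrow> nat \<Rightarrow> real) \<Rightarrow> (nat \<Rightarrow> nat \<Rightarrow> 'a) \<Rightarrow> (nat \<Rightarrow> nat \<Rightarrow> 'a) \<Rightarrow> bool" where
  "efficient_projection h c x J \<mu> d p \<longleftrightarrow>
    (\<forall>z. C2_near c z \<and> \<bar>h (c z)\<bar> \<noteq> \<infinity> \<and> lsc_near h (c z) \<and> transversal h c z \<longrightarrow>
      (\<exists>\<gamma>>0. \<exists>\<delta>>0. \<forall>k. \<forall>i\<le>J k.
        prox_step h c (x k) (\<mu> k i) (d k i) \<and>
        x k \<in> cball z \<delta> \<and> d k i \<in> cball 0 \<delta> \<and>
        \<bar>h (linearization c (x k) (d k i)) - h (c z)\<bar> < ereal \<delta> \<longrightarrow>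
          norm (p k i - (x k + d k i)) \<le> \<gamma> * (norm (d k i))\<^sup>2 \<and>
          h (c (p k i)) \<le> h (linearization c (x k) (d k i)) + ereal (\<gamma> * (norm (d k i))\<^sup>2)))"

end

theory Submission
  imports Defs
begin

text \<open>Suppose that \<open>xbar\<close> is not critical. A limiting argument with proximal subgradients then shows
  that every step \<open>d\<close> computed near \<open>(xbar, h (c xbar))\<close> satisfies \<open>\<mu> * norm d \<ge> \<kappa>\<close> for a fixed
  \<open>\<kappa> > 0\<close>, so that an accepted step decreases \<open>h \<circ> c\<close> by at least a multiple of its length. Since the
  values \<open>h (c (x k))\<close> decrease to \<open>h (c xbar)\<close>, the iterates have no decrease left to leave a
  neighbourhood of \<open>xbar\<close> once they have come close enough. In that neighbourhood every step with a
  large \<open>\<mu>\<close> exists and is accepted, so \<open>\<mu>\<close> stays bounded; but \<open>\<mu> \<ge> \<mu>min\<close> and the convergence of the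
  values force the accepted steps to tend to \<open>0\<close>, which contradicts \<open>\<mu> * norm d \<ge> \<kappa>\<close>.\<close>

section \<open>Pointwise lower semicontinuity and attainment of minima\<close>

definition lsc_at :: "('a::topological_space \<Rightarrow> ereal) \<Rightarrow> 'a \<Rightarrow> bool" where
  "lsc_at f y \<longleftrightarrow> (\<forall>a<f y. \<forall>\<^sub>F z in nhds y. a < f z)"

lemma lsc_at_tendsto:
  assumes "lsc_at f y" and "(g \<longlongrightarrow> y) F" and "a < f y"
  shows "\<forall>\<^sub>F n in F. a < f (g n)"
  using assms unfolding lsc_at_def by (auto elim: eventually_compose_filterlim)

text \<open>The liminf inequality unfolds into the threshold form on a punctured neighbourhood, and
  the centre itself satisfies every threshold below its value. This yields a whole ball of such
  points, as the compactness arguments require.\<close>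

lemma lsc_near_imp_lsc_at_ball:
  fixes h :: "'a::metric_space \<Rightarrow> ereal"
  assumes "lsc_near h y"
  obtains R where "R > 0" and "\<And>z. z \<in> ball y R \<Longrightarrow> lsc_at h z"
proof -
  have *: "lsc_at h z" if "h z \<le> Liminf (at z) h" for z
    using that unfolding le_Liminf_iff lsc_at_def eventually_nhds_conv_at by auto
  obtain R where "R > 0" and "\<forall>z. dist z y < R \<longrightarrow> h z \<le> Liminf (at z) h"
    using assms unfolding lsc_near_def eventually_nhds_metric by auto
  then show ?thesis
    using that * by (auto simp: dist_commute)
qed

lemma lsc_at_compose:
  assumes "lsc_at f (g w)" and "isCont g w"
  shows "lsc_at (\<lambda>w. f (g w)) w"
proof -
  have "(g \<longlongrightarrow> g w) (nhds w)"
    using assms(2) by (simp add: continuous_at tendsto_at_iff_tendsto_nhds)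
  then show ?thesis
    using assms(1) lsc_at_tendsto unfolding lsc_at_def[of "\<lambda>w. f (g w)"] by blast
qed

text \<open>The gap between \<open>a\<close> and the sum is split by reals: \<open>b\<close> lies
  below \<open>f w\<close> and \<open>b' - b\<close> below \<open>g w\<close>, so each summand is
  controlled on its own neighbourhood. Since \<open>g\<close> is finite, infinite values of
  \<open>f\<close> cause no indeterminate form.\<close>

lemma lsc_at_add_real:
  fixes f :: "'a::t2_space \<Rightarrow> ereal" and g :: "'a \<Rightarrow> real"
  assumes "lsc_at f w" and "isCont g w"
  shows "lsc_at (\<lambda>w. f w + ereal (g w)) w"
  unfolding lsc_at_def
proof (intro allI impI)
  fix a assume a: "a < f w + ereal (g w)"
  then have "a - ereal (g w) < f w"
    by (cases a; cases "f w") auto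
  then obtain b where b: "a - ereal (g w) < ereal b" "ereal b < f w"
    using ereal_dense2 by blast
  have "a < ereal (b + g w)"
    using b(1) by (cases a) auto
  then obtain b' where b': "a < ereal b'" "b' < b + g w"
    using ereal_dense2 by force
  have "(g \<longlongrightarrow> g w) (nhds w)"
    using assms(2) by (simp add: continuous_at tendsto_at_iff_tendsto_nhds)
  then have "\<forall>\<^sub>F z in nhds w. b' - b < g z"
    using b'(2) by (auto intro!: order_tendstoD)
  moreover have "\<forall>\<^sub>F z in nhds w. ereal b < f z"
    using assms(1) b(2) unfolding lsc_at_def by blast
  ultimately show "\<forall>\<^sub>F z in nhds w. a < f z + ereal (g z)"
  proof eventually_elim
    case (elim z)
    have "ereal b' \<le> f z + ereal (g z)"
      using elim by (cases "f z") auto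
    then show ?case
      using b'(1) by order
  qed
qed

text \<open>The direct method: a minimizing sequence has a convergent subsequence in
  \<open>K\<close>, and lower semicontinuity keeps the value at the limit from exceeding the
  infimum, which exists in the extended reals.\<close>

lemma lsc_attains_min:
  fixes f :: "'a::metric_space \<Rightarrow> ereal"
  assumes "compact K" and "K \<noteq> {}" and lsc: "\<And>y. y \<in> K \<Longrightarrow> lsc_at f y"
  shows "\<exists>y\<in>K. \<forall>z\<in>K. f y \<le> f z"
proof -
  obtain u where u: "\<And>n. u n \<in> f ` K" "u \<longlonglongrightarrow> Inf (f ` K)"
    using Inf_as_limit[of "f ` K"] assms(2) by auto
  obtain s where s: "\<And>n. s n \<in> K" "\<And>n. u n = f (s n)"
    using u(1) by (auto simp: image_iff) metis
  obtain l r where l: "l \<in> K" "strict_mono (r::nat\<Rightarrow>nat)" "(s \<circ> r) \<longlonglongrightarrow> l"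
    using assms(1) s(1) unfolding compact_def by meson
  have "f l \<le> Inf (f ` K)"
  proof (rule ccontr)
    assume "\<not> ?thesis"
    then obtain a where a: "Inf (f ` K) < a" "a < f l"
      by (meson dense not_le)
    have "\<forall>\<^sub>F n in sequentially. a < f ((s \<circ> r) n)"
      using lsc_at_tendsto[OF lsc[OF l(1)] l(3) a(2)] .
    moreover have "\<forall>\<^sub>F n in sequentially. (u \<circ> r) n < a"
      using order_tendstoD(2)[OF LIMSEQ_subseq_LIMSEQ[OF u(2) l(2)] a(1)] .
    ultimately have "\<forall>\<^sub>F n::nat in sequentially. False"
      by eventually_elim (auto simp: s(2))
    then show False by simp
  qed
  then show ?thesis
    using l(1) by (meson INF_lower order.trans)
qed

section \<open>Proximal subgradients and normals to the epigraph\<close>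

text \<open>Slopes of local quadratic minorants. The curvature \<rho> may vary with \<open>v\<close>
  and \<open>y\<close>, so limits of such slopes carry no curvature bound; penalty minimization
  produces slopes of exactly this kind.\<close>

definition prox_subdiff :: "('a::real_inner \<Rightarrow> ereal) \<Rightarrow> 'a \<Rightarrow> 'a set" where
  "prox_subdiff h y =
    {v. \<exists>\<rho>. \<forall>\<^sub>F z in nhds y. h y + ereal (v \<bullet> (z - y) - \<rho> * (norm (z - y))\<^sup>2) \<le> h z}"

text \<open>A small enough ball touching the graph of the quadratic minorant from below at
  \<open>(y, r)\<close> meets the epigraph in no interior point, so \<open>(y, r)\<close> is a
  closest point to its centre.\<close>

lemma prox_subdiff_projection:
  fixes h :: "'a::real_inner \<Rightarrow> ereal"
  assumes hy: "h y = ereal r" and v: "v \<in> prox_subdiff h y" and "0 < \<epsilon>"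
  obtains t where "0 < t" "t < \<epsilon>"
    and "\<And>q. q \<in> epi h \<Longrightarrow> dist ((y, r) + t *\<^sub>R (v, -1)) (y, r) \<le> dist ((y, r) + t *\<^sub>R (v, -1)) q"
proof -
  obtain \<rho>0 \<eta> where \<eta>: "\<eta> > 0"
    and sub0: "\<And>z. dist z y < \<eta> \<Longrightarrow> h y + ereal (v \<bullet> (z - y) - \<rho>0 * (norm (z - y))\<^sup>2) \<le> h z"
    using v unfolding prox_subdiff_def eventually_nhds_metric by auto
  \<comment> \<open>Enlarging the curvature only weakens the minorant; positivity lets
    \<open>1 / (2 * \<rho>)\<close> serve as a bound on \<open>t\<close>.\<close>
  define \<rho> where "\<rho> = max \<rho>0 1"
  have "\<rho> > 0" by (simp add: \<rho>_def)
  have sub: "r + v \<bullet> (z - y) - \<rho> * (norm (z - y))\<^sup>2 \<le> s"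
    if "dist z y < \<eta>" "h z \<le> ereal s" for z s
  proof -
    have "ereal (r + (v \<bullet> (z - y) - \<rho>0 * (norm (z - y))\<^sup>2)) \<le> ereal s"
      using order.trans[OF sub0[OF that(1)] that(2)] hy by simp
    moreover have "\<rho>0 * (norm (z - y))\<^sup>2 \<le> \<rho> * (norm (z - y))\<^sup>2"
      unfolding \<rho>_def by (intro mult_right_mono) auto
    ultimately show ?thesis by simp
  qed
  define N where "N = norm (v, -1::real)"
  have "N > 0" by (auto simp: N_def zero_prod_def)
  \<comment> \<open>The bounds serve in turn the demand \<open>t < \<epsilon>\<close>, the
    absorption of the quadratic error, and the points of the epigraph beyond the range \<eta> of the
    minorant.\<close>
  define t where "t = min (\<epsilon> / 2) (min (1 / (2 * \<rho>)) (\<eta> / (2 * N)))"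
  have t: "0 < t" "t < \<epsilon>" "t \<le> 1 / (2 * \<rho>)" "t \<le> \<eta> / (2 * N)"
    using \<open>\<epsilon> > 0\<close> \<open>\<rho> > 0\<close> \<open>\<eta> > 0\<close> \<open>N > 0\<close> by (auto simp: t_def min_def)
  then have t': "2 * t * \<rho> \<le> 1" "2 * (t * N) \<le> \<eta>"
    using \<open>\<rho> > 0\<close> \<open>N > 0\<close> by (auto simp: field_simps)
  let ?u = "(y, r) + t *\<^sub>R (v, -1)"
  have d0: "dist ?u (y, r) = t * N"
    using t(1) by (simp add: dist_norm N_def del: scaleR_Pair)
  have "t * N \<le> dist ?u q" if inq: "q \<in> epi h" for q
  proof -
    obtain z s where q: "q = (z, s)" "h z \<le> ereal s"
      using inq by (cases q) (auto simp: epi_def)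
    show ?thesis
    proof (cases "dist z y < \<eta>")
      case True
      have N2: "N\<^sup>2 = v \<bullet> v + 1"
        by (simp add: N_def norm_Pair flip: power2_norm_eq_inner)
      have "(dist ?u q)\<^sup>2 = (norm (t *\<^sub>R v - (z - y)))\<^sup>2 + (r - t - s)\<^sup>2"
        by (simp add: q dist_norm norm_Pair algebra_simps)
      also have "\<dots> = t\<^sup>2 * (v \<bullet> v) - 2 * t * (v \<bullet> (z - y)) + (norm (z - y))\<^sup>2 + (r - t - s)\<^sup>2"
        unfolding power2_norm_eq_inner
        by (simp add: inner_diff_left inner_diff_right inner_commute power2_eq_square algebra_simps)
      \<comment> \<open>The bracket in the last term is at least \<open>-\<rho>\<close> times the
        square of \<open>norm (z - y)\<close>; since \<open>2 * t * \<rho> \<le> 1\<close>, the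
        second term absorbs it.\<close>
      also have "\<dots> = (t * N)\<^sup>2 + (norm (z - y))\<^sup>2 + (r - s)\<^sup>2 + 2 * t * (s - r - v \<bullet> (z - y))"
        unfolding power_mult_distrib N2 by (simp add: power2_eq_square algebra_simps)
      also have "\<dots> \<ge> (t * N)\<^sup>2"
      proof -
        have "2 * t * (- (\<rho> * (norm (z - y))\<^sup>2)) \<le> 2 * t * (s - r - v \<bullet> (z - y))"
          using sub[OF True q(2)] t(1) by (intro mult_left_mono) auto
        then have "- (2 * t * \<rho> * (norm (z - y))\<^sup>2) \<le> 2 * t * (s - r - v \<bullet> (z - y))"
          by (simp only: mult_minus_right mult.assoc)
        moreover have "2 * t * \<rho> * (norm (z - y))\<^sup>2 \<le> 1 * (norm (z - y))\<^sup>2"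
          using t'(1) by (intro mult_right_mono) auto
        ultimately show ?thesis
          using zero_le_power2[of "r - s"] by linarith
      qed
      finally show ?thesis
        by (rule power2_le_imp_le) simp
    next
      case False
      have "\<eta> \<le> dist (y, r) q"
        using False dist_fst_le[of q "(y, r)"] by (simp add: q dist_commute)
      also have "\<dots> \<le> dist ?u (y, r) + dist ?u q"
        by (metis dist_commute dist_triangle)
      finally show ?thesis
        using t'(2) d0 by simp
    qed
  qed
  then show ?thesis
    using that[of t] t d0 by simp
qed

text \<open>Each \<open>(v k, -1)\<close> points from \<open>(y k, r k)\<close> to a point
  projecting back onto it, and that point may be taken as close as desired. A diagonal choice makes
  both sequences converge to \<open>(y0, r0)\<close>, while the positive factors restore the
  prescribed scaling.\<close>

lemma normal_cone_epi_limit: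
  fixes h :: "'a::euclidean_space \<Rightarrow> ereal"
  assumes v: "\<And>k. v k \<in> prox_subdiff h (y k)" and h: "\<And>k. h (y k) = ereal (r k)"
    and y: "y \<longlonglongrightarrow> y0" and r: "r \<longlonglongrightarrow> r0"
    and a: "\<And>k. a k > 0" and w: "(\<lambda>k. a k *\<^sub>R (v k, -1)) \<longlonglongrightarrow> w"
  shows "w \<in> normal_cone (epi h) (y0, r0)"
proof -
  define N where "N k = norm (v k, -1::real)" for k
  have N: "N k > 0" for k by (auto simp: N_def zero_prod_def)
  \<comment> \<open>Dividing by \<open>N k\<close> keeps the displacement
    \<open>t *\<^sub>R (v k, -1)\<close> shorter than \<open>1 / (k + 1)\<close> even when the
    \<open>v k\<close> are unbounded.\<close>
  have "\<exists>t. 0 < t \<and> t < inverse (real (Suc k)) / N k \<and>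
          (\<forall>q\<in>epi h. dist ((y k, r k) + t *\<^sub>R (v k, -1)) (y k, r k)
             \<le> dist ((y k, r k) + t *\<^sub>R (v k, -1)) q)" for k
    using prox_subdiff_projection[OF h[of k] v[of k], of "inverse (real (Suc k)) / N k"] N[of k]
    by (metis divide_pos_pos inverse_positive_iff_positive of_nat_0_less_iff zero_less_Suc)
  then obtain t where t: "\<And>k. 0 < t k" "\<And>k. t k < inverse (real (Suc k)) / N k"
      "\<And>k q. q \<in> epi h \<Longrightarrow> dist ((y k, r k) + t k *\<^sub>R (v k, -1)) (y k, r k)
             \<le> dist ((y k, r k) + t k *\<^sub>R (v k, -1)) q"
    by metis
  let ?u = "\<lambda>k. (y k, r k) + t k *\<^sub>R (v k, -1)"
  have "norm (t k *\<^sub>R (v k, -1::real)) \<le> inverse (real (Suc k))" for k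
    using t(1,2)[of k] N[of k]
    by (simp add: N_def[symmetric] pos_less_divide_eq less_imp_le del: scaleR_Pair)
  then have "(\<lambda>k. t k *\<^sub>R (v k, -1::real)) \<longlonglongrightarrow> 0"
    by (intro Lim_null_comparison[OF _ LIMSEQ_inverse_real_of_nat]) auto
  moreover have yr: "(\<lambda>k. (y k, r k)) \<longlonglongrightarrow> (y0, r0)"
    using y r by (intro tendsto_Pair)
  ultimately have "?u \<longlonglongrightarrow> (y0, r0)"
    using tendsto_add by fastforce
  moreover have "(\<lambda>k. (a k / t k) *\<^sub>R (?u k - (y k, r k))) \<longlonglongrightarrow> w"
  proof -
    have "(a k / t k) *\<^sub>R (?u k - (y k, r k)) = a k *\<^sub>R (v k, -1)" for k
      using t(1)[of k] by simp
    then show ?thesis using w by simp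
  qed
  moreover have "(y k, r k) \<in> epi h" for k
    by (simp add: epi_def h)
  moreover have "a k / t k > 0" for k
    using a t(1) by simp
  ultimately show ?thesis
    unfolding normal_cone_def mem_Collect_eq
    by (intro exI[of _ "\<lambda>k. a k / t k"] exI[of _ ?u] exI[of _ "\<lambda>k. (y k, r k)"] conjI allI ballI t(3) yr)
qed

lemma normal_cone_scaleR:
  assumes "w \<in> normal_cone S s" and "t > 0"
  shows "t *\<^sub>R w \<in> normal_cone S s"
proof -
  obtain l u v where luv: "\<forall>k. l k > 0 \<and> v k \<in> S \<and> (\<forall>z\<in>S. dist (u k) (v k) \<le> dist (u k) z)"
      "u \<longlonglongrightarrow> s" "v \<longlonglongrightarrow> s" "(\<lambda>k::nat. l k *\<^sub>R (u k - v k)) \<longlonglongrightarrow> w"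
    using assms(1) unfolding normal_cone_def by blast
  have "(\<lambda>k. (t * l k) *\<^sub>R (u k - v k)) \<longlonglongrightarrow> t *\<^sub>R w"
    using tendsto_scaleR[OF tendsto_const[of t] luv(4)] by simp
  then show ?thesis
    unfolding normal_cone_def using luv assms(2)
    by (intro CollectI exI[of _ "\<lambda>k. t * l k"] exI[of _ u] exI[of _ v]) auto
qed

text \<open>A fuzzy multiplier rule: an exact multiplier at \<open>b + A d0\<close> may fail to
  exist without a constraint qualification, but stationarity holds up to \<epsilon> with a proximal
  subgradient at a nearby point of nearby value.\<close>

lemma prox_subdiff_near_local_minimizer:
  fixes h :: "'b::euclidean_space \<Rightarrow> ereal" and A :: "'a::euclidean_space \<Rightarrow> 'b"
  assumes A: "linear A" and pb: "prox_bounded h" and \<mu>: "\<mu> \<ge> 0"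
    and R: "R > 0" and lsc: "\<And>z. z \<in> cball (b + A d0) R \<Longrightarrow> lsc_at h z"
    and fin: "h (b + A d0) = ereal r0"
    and lm: "local_minimizer (\<lambda>d. h (b + A d) + ereal (\<mu> / 2 * (norm d)\<^sup>2)) d0"
    and \<epsilon>: "\<epsilon> > 0"
  obtains y r v where "dist y (b + A d0) < \<epsilon>" and "h y = ereal r" and "\<bar>r - r0\<bar> < \<epsilon>"
    and "v \<in> prox_subdiff h y" and "norm (adjoint A v + \<mu> *\<^sub>R d0) < \<epsilon>"
proof -
  interpret A: bounded_linear A
    using A by (simp add: linear_conv_bounded_linear)
  define y0 where "y0 = b + A d0"
  define V where "V = r0 + \<mu> / 2 * (norm d0)\<^sup>2"
  obtain \<eta>' where \<eta>': "\<eta>' > 0" "\<And>d. dist d d0 < \<eta>' \<Longrightarrow>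
      h (b + A d0) + ereal (\<mu> / 2 * (norm d0)\<^sup>2) \<le> h (b + A d) + ereal (\<mu> / 2 * (norm d)\<^sup>2)"
    using lm unfolding local_minimizer_def eventually_nhds_metric by auto
  \<comment> \<open>Halving puts the closed ball, which compactness calls for, inside the open
    region of local minimality.\<close>
  define \<eta> where "\<eta> = \<eta>' / 2"
  have \<eta>: "\<eta> > 0" "\<And>d. d \<in> cball d0 \<eta> \<Longrightarrow> ereal (V - \<mu> / 2 * (norm d)\<^sup>2) \<le> h (b + A d)"
  proof -
    show "\<eta> > 0" using \<eta>' by (simp add: \<eta>_def)
    fix d assume "d \<in> cball d0 \<eta>"
    then have "ereal V \<le> h (b + A d) + ereal (\<mu> / 2 * (norm d)\<^sup>2)"
      using \<eta>'(2)[of d] \<eta>'(1) fin by (simp add: V_def \<eta>_def dist_commute)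
    then show "ereal (V - \<mu> / 2 * (norm d)\<^sup>2) \<le> h (b + A d)"
      by (cases "h (b + A d)") auto
  qed
  obtain h0 q0 where q: "q0 \<ge> 0" "\<And>y. ereal (h0 - q0 * (norm y)\<^sup>2) \<le> h y"
    using pb unfolding prox_bounded_def by auto
  \<comment> \<open>This finite lower bound of \<open>h\<close> on the ball excludes the value
    \<open>-\<infinity>\<close> and later caps the penalty term.\<close>
  define m where "m = h0 - q0 * (norm y0 + R)\<^sup>2"
  have m: "ereal m \<le> h y" if "y \<in> cball y0 R" for y
  proof -
    have "norm y \<le> norm y0 + R"
      using that norm_triangle_ineq2[of y y0] by (simp add: dist_norm norm_minus_commute)
    then have "q0 * (norm y)\<^sup>2 \<le> q0 * (norm y0 + R)\<^sup>2"
      using q(1) by (intro mult_left_mono power_mono) auto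
    then have "ereal m \<le> ereal (h0 - q0 * (norm y)\<^sup>2)"
      by (simp add: m_def)
    then show ?thesis using q(2)[of y] by order
  qed

  txt \<open>Relax the constraint \<open>y = b + A d\<close> by a quadratic penalty, so that stationarity holds in \<open>y\<close>
    and \<open>d\<close> separately. The last term makes the penalized minimizers converge to \<open>(b + A d0, d0)\<close>
    although \<open>d0\<close> need not be a strict minimizer.\<close>
  define g where "g n w = real n / 2 * (norm (fst w - b - A (snd w)))\<^sup>2 + \<mu> / 2 * (norm (snd w))\<^sup>2
      + 1 / 2 * (norm (snd w - d0))\<^sup>2" for n :: nat and w :: "'b \<times> 'a"
  define K where "K = cball y0 R \<times> cball d0 \<eta>"
  have K: "compact K" "(y0, d0) \<in> K"
    using R \<eta>(1) by (auto simp: K_def intro: compact_Times)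
  have lscG: "lsc_at (\<lambda>w. h (fst w) + ereal (g n w)) w" if "w \<in> K" for n w
  proof (rule lsc_at_add_real)
    have "lsc_at h (fst w)"
      using that lsc by (auto simp: K_def y0_def)
    then show "lsc_at (\<lambda>w. h (fst w)) w"
      by (rule lsc_at_compose) (intro continuous_intros)
    have "continuous_on UNIV (g n)"
      unfolding g_def by (intro continuous_intros A.continuous_on)
    then show "isCont (g n) w"
      using continuous_on_eq_continuous_at[OF open_UNIV] by blast
  qed
  have "\<exists>w\<in>K. \<forall>z\<in>K. h (fst w) + ereal (g n w) \<le> h (fst z) + ereal (g n z)" for n
    by (rule lsc_attains_min[OF K(1)]) (use K(2) lscG in auto)
  then obtain w where w: "\<And>n. w n \<in> K"
      "\<And>n z. z \<in> K \<Longrightarrow> h (fst (w n)) + ereal (g n (w n)) \<le> h (fst z) + ereal (g n z)"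
    by metis
  have g0: "g n (y0, d0) = \<mu> / 2 * (norm d0)\<^sup>2" for n
    by (simp add: g_def y0_def)
  then have le: "h (fst (w n)) + ereal (g n (w n)) \<le> ereal V" for n
    using w(2)[OF K(2), of n] fin unfolding V_def g0 by (simp add: y0_def)
  have "\<exists>s. h (fst (w n)) = ereal s" for n
    using le[of n] m[of "fst (w n)"] w(1)[of n] by (cases "h (fst (w n))") (auto simp: K_def)
  then obtain s where s: "\<And>n. h (fst (w n)) = ereal (s n)"
    by metis
  have sV: "s n + g n (w n) \<le> V" for n
    using le[of n] s by simp
  have sm: "m \<le> s n" for n
    using m[of "fst (w n)"] w(1)[of n] s by (auto simp: K_def)

  obtain ws \<rho> where ws: "ws \<in> K" "strict_mono (\<rho>::nat\<Rightarrow>nat)" "(w \<circ> \<rho>) \<longlonglongrightarrow> ws"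
    using K(1) w(1) unfolding compact_def by meson
  define Y D where "Y = (\<lambda>n. fst (w (\<rho> n)))" and "D = (\<lambda>n. snd (w (\<rho> n)))"
  obtain ys ds where wse: "ws = (ys, ds)" by fastforce
  have YD: "Y \<longlonglongrightarrow> ys" "D \<longlonglongrightarrow> ds"
    using tendsto_fst[OF ws(3)] tendsto_snd[OF ws(3)] by (auto simp: Y_def D_def wse comp_def)
  \<comment> \<open>Comparison with \<open>(y0, d0)\<close>, where the penalty vanishes, bounds the
    penalty by \<open>V - m\<close>. Its weight \<open>\<rho> n\<close> is at least
    \<open>n\<close>, so the residual vanishes and the limit satisfies the constraint.\<close>
  have e_bound: "(norm (Y n - b - A (D n)))\<^sup>2 \<le> 2 * (V - m) * inverse (real n)" if "n > 0" for n
  proof -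
    have "real n / 2 * (norm (Y n - b - A (D n)))\<^sup>2 \<le> real (\<rho> n) / 2 * (norm (Y n - b - A (D n)))\<^sup>2"
      using seq_suble[OF ws(2), of n] by (intro mult_right_mono) auto
    also have "\<dots> \<le> g (\<rho> n) (w (\<rho> n))"
      using \<mu> by (simp add: g_def Y_def D_def)
    also have "\<dots> \<le> V - m"
      using sV[of "\<rho> n"] sm[of "\<rho> n"] by simp
    finally show ?thesis using that by (simp add: field_simps)
  qed
  have "(\<lambda>n. (norm (Y n - b - A (D n)))\<^sup>2) \<longlonglongrightarrow> 0"
  proof (rule Lim_null_comparison)
    show "(\<lambda>n. 2 * (V - m) * inverse (real n)) \<longlonglongrightarrow> 0"
      using tendsto_mult[OF tendsto_const[of "2 * (V - m)"] lim_inverse_n[where 'a=real]] by simp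
  qed (use e_bound in \<open>auto intro: eventually_sequentiallyI[of 1]\<close>)
  moreover have "(\<lambda>n. (norm (Y n - b - A (D n)))\<^sup>2) \<longlonglongrightarrow> (norm (ys - b - A ds))\<^sup>2"
    by (intro tendsto_intros A.tendsto YD)
  ultimately have "(norm (ys - b - A ds))\<^sup>2 = 0"
    using LIMSEQ_unique by blast
  then have ys: "ys = b + A ds" by (simp add: algebra_simps)
  have sD: "s (\<rho> n) \<le> V - \<mu> / 2 * (norm (D n))\<^sup>2 - 1 / 2 * (norm (D n - d0))\<^sup>2" for n
  proof -
    have "\<mu> / 2 * (norm (D n))\<^sup>2 + 1 / 2 * (norm (D n - d0))\<^sup>2 \<le> g (\<rho> n) (w (\<rho> n))"
      by (simp add: g_def D_def)
    then show ?thesis using sV[of "\<rho> n"] by simp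
  qed
  have lscy: "lsc_at h ys" using lsc ws(1) by (simp add: K_def wse y0_def)
  have "ds = d0"
  proof (rule ccontr)
    assume "ds \<noteq> d0"
    \<comment> \<open>Local minimality bounds the value at \<open>ys\<close> below, whereas
      \<open>sD\<close> forces a drop with coefficient \<open>1 / 2\<close>. The intermediate
      coefficient \<open>1 / 4\<close> makes the two incompatible in the limit.\<close>
    define a where "a = V - \<mu> / 2 * (norm ds)\<^sup>2 - 1 / 4 * (norm (ds - d0))\<^sup>2"
    have "ereal a < ereal (V - \<mu> / 2 * (norm ds)\<^sup>2)"
      using \<open>ds \<noteq> d0\<close> by (simp add: a_def)
    also have "\<dots> \<le> h ys"
      using \<eta>(2) ws(1) by (simp add: K_def wse ys)
    finally have "\<forall>\<^sub>F n in sequentially. ereal a < h (Y n)"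
      using lsc_at_tendsto[OF lscy YD(1)] by simp
    then have "\<forall>\<^sub>F n in sequentially. a \<le> V - \<mu> / 2 * (norm (D n))\<^sup>2 - 1 / 2 * (norm (D n - d0))\<^sup>2"
      by eventually_elim (use sD in \<open>auto simp: Y_def s intro: less_imp_le order_less_le_trans\<close>)
    moreover have "(\<lambda>n. V - \<mu> / 2 * (norm (D n))\<^sup>2 - 1 / 2 * (norm (D n - d0))\<^sup>2)
        \<longlonglongrightarrow> V - \<mu> / 2 * (norm ds)\<^sup>2 - 1 / 2 * (norm (ds - d0))\<^sup>2"
      by (intro tendsto_intros YD)
    ultimately have "a \<le> V - \<mu> / 2 * (norm ds)\<^sup>2 - 1 / 2 * (norm (ds - d0))\<^sup>2"
      by (intro tendsto_lowerbound) auto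
    then show False
      using \<open>ds \<noteq> d0\<close> by (simp add: a_def)
  qed
  then have ysy0: "ys = y0" by (simp add: ys y0_def)

  have "\<forall>\<^sub>F n in sequentially. dist (Y n) y0 < min \<epsilon> R"
    using tendstoD[OF YD(1), of "min \<epsilon> R"] \<epsilon> R by (simp add: ysy0)
  \<comment> \<open>The final stationarity error turns out to be
    \<open>(1 + \<mu>) * dist d d0\<close>, whence the divisor \<open>1 + \<mu>\<close>.\<close>
  moreover have "\<forall>\<^sub>F n in sequentially. dist (D n) d0 < min \<eta> (\<epsilon> / (1 + \<mu>))"
    using tendstoD[OF YD(2), of "min \<eta> (\<epsilon> / (1 + \<mu>))"] \<epsilon> \<mu> \<eta>(1) \<open>ds = d0\<close> by simp
  \<comment> \<open>Lower semicontinuity controls the values from below only; the matching upper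
    bound comes from \<open>sD\<close> and the convergence of \<open>D\<close> to
    \<open>d0\<close>.\<close>
  moreover have "\<forall>\<^sub>F n in sequentially. ereal (r0 - \<epsilon>) < h (Y n)"
    using lsc_at_tendsto[OF lscy YD(1)] fin \<epsilon> by (simp add: ysy0 y0_def)
  moreover have "\<forall>\<^sub>F n in sequentially. V - \<mu> / 2 * (norm (D n))\<^sup>2 < r0 + \<epsilon>"
  proof (rule order_tendstoD)
    show "(\<lambda>n. V - \<mu> / 2 * (norm (D n))\<^sup>2) \<longlonglongrightarrow> V - \<mu> / 2 * (norm ds)\<^sup>2"
      by (intro tendsto_intros YD)
  qed (simp add: V_def \<open>ds = d0\<close> \<epsilon>)
  ultimately have "\<forall>\<^sub>F n in sequentially. dist (Y n) y0 < min \<epsilon> R \<and>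
      dist (D n) d0 < min \<eta> (\<epsilon> / (1 + \<mu>)) \<and> r0 - \<epsilon> < s (\<rho> n) \<and> V - \<mu> / 2 * (norm (D n))\<^sup>2 < r0 + \<epsilon>"
    by eventually_elim (simp add: Y_def s)
  then obtain N where N: "dist (Y N) y0 < min \<epsilon> R" "dist (D N) d0 < min \<eta> (\<epsilon> / (1 + \<mu>))"
      "r0 - \<epsilon> < s (\<rho> N)" "V - \<mu> / 2 * (norm (D N))\<^sup>2 < r0 + \<epsilon>"
    by (auto simp: eventually_sequentially)
  define y d n where "y = Y N" and "d = D N" and "n = \<rho> N"
  define e where "e = y - b - A d"
  \<comment> \<open>The multiplier of the relaxed constraint: the negative gradient of the penalty
    in \<open>y\<close>. Minimality in \<open>y\<close> with \<open>d\<close> frozen makes it a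
    proximal subgradient with curvature constant \<open>n / 2\<close>.\<close>
  define v where "v = - (real n *\<^sub>R e)"
  have wn: "w n = (y, d)" by (simp add: y_def d_def n_def Y_def D_def)
  have hy: "h y = ereal (s n)" using s[of n] by (simp add: wn)
  have "s n < r0 + \<epsilon>"
    using sD[of N] N(4) zero_le_power2[of "norm (D N - d0)"] unfolding n_def by linarith

  have subgrad: "h y + ereal (v \<bullet> (z - y) - real n / 2 * (norm (z - y))\<^sup>2) \<le> h z"
    if "dist z y0 < R" for z
  proof -
    have "(z, d) \<in> K" using that N(2) by (simp add: K_def d_def dist_commute)
    then have "ereal (s n + g n (y, d)) \<le> h z + ereal (g n (z, d))"
      using w(2)[of "(z, d)" n] by (simp add: wn hy)
    moreover have "g n (z, d) - g n (y, d) = real n / 2 * (norm (z - y))\<^sup>2 - v \<bullet> (z - y)"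
    proof -
      have "(norm (z - b - A d))\<^sup>2 = (norm ((z - y) + e))\<^sup>2" by (simp add: e_def algebra_simps)
      also have "\<dots> = (norm (z - y))\<^sup>2 + 2 * (e \<bullet> (z - y)) + (norm e)\<^sup>2"
        by (simp only: power2_norm_eq_inner inner_add_left inner_add_right)
           (simp add: inner_commute)
      finally have "(norm (z - b - A d))\<^sup>2 = (norm (z - y))\<^sup>2 + 2 * (e \<bullet> (z - y)) + (norm e)\<^sup>2" .
      then show ?thesis
        unfolding g_def fst_conv snd_conv e_def[symmetric]
        by (simp add: v_def distrib_left)
    qed
    ultimately show ?thesis
      by (cases "h z") (auto simp: hy)
  qed
  have "\<forall>\<^sub>F z in nhds y. dist z y0 < R"
    using N(1) eventually_nhds_in_open[of "ball y0 R" y] by (simp add: y_def dist_commute)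
  then have "\<forall>\<^sub>F z in nhds y. h y + ereal (v \<bullet> (z - y) - real n / 2 * (norm (z - y))\<^sup>2) \<le> h z"
    by eventually_elim (rule subgrad)
  then have vsub: "v \<in> prox_subdiff h y"
    unfolding prox_subdiff_def by blast

  \<comment> \<open>With \<open>y\<close> frozen the objective is smooth in \<open>d\<close>, and
    its vanishing gradient reads
    \<open>adjoint A v + \<mu> *\<^sub>R d + (d - d0) = 0\<close>.\<close>
  define q where "q d = g n (y, d)" for d
  have "(q has_derivative (\<lambda>k. - (real n * (e \<bullet> A k)) + \<mu> * (d \<bullet> k) + (d - d0) \<bullet> k)) (at d)"
    unfolding q_def g_def power2_norm_eq_inner e_def fst_conv snd_conv
    by (rule derivative_eq_intros A.has_derivative refl)+
       (simp add: fun_eq_iff inner_commute algebra_simps inner_diff_left inner_diff_right)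
  moreover have "q d \<le> q d'" if "d' \<in> ball d0 \<eta>" for d'
  proof -
    have "(y, d') \<in> K" using that N(1) by (simp add: K_def y_def dist_commute)
    then show ?thesis
      using w(2)[of "(y, d')" n] by (simp add: wn hy q_def)
  qed
  moreover have "d \<in> ball d0 \<eta>" using N(2) by (simp add: d_def dist_commute)
  ultimately have stat: "(\<lambda>k. - (real n * (e \<bullet> A k)) + \<mu> * (d \<bullet> k) + (d - d0) \<bullet> k) = (\<lambda>k. 0)"
    by (intro differential_zero_maxmin[of d "ball d0 \<eta>" q]) auto
  have "k \<bullet> adjoint A v = k \<bullet> (- (\<mu> *\<^sub>R d + (d - d0)))" for k
    using fun_cong[OF stat, of k] unfolding adjoint_works[OF A]
    by (simp add: v_def inner_commute inner_add_right inner_diff_right)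
  then have "adjoint A v = - (\<mu> *\<^sub>R d + (d - d0))"
    using vector_eq_ldot by blast
  then have "adjoint A v + \<mu> *\<^sub>R d0 = - ((1 + \<mu>) *\<^sub>R (d - d0))"
    by (simp add: algebra_simps)
  then have "norm (adjoint A v + \<mu> *\<^sub>R d0) = (1 + \<mu>) * dist d d0"
    using \<mu> by (simp add: dist_norm)
  also have "\<dots> < \<epsilon>" using N(2) \<mu> by (simp add: d_def field_simps)
  finally have "norm (adjoint A v + \<mu> *\<^sub>R d0) < \<epsilon>" .
  then show ?thesis
    using that[OF _ hy _ vsub] N \<open>s n < r0 + \<epsilon>\<close>
    by (simp add: y_def n_def y0_def abs_less_iff)
qed

lemma subdiff_kernel_limit:
  fixes h :: "'b::euclidean_space \<Rightarrow> ereal" and A :: "nat \<Rightarrow> 'a::euclidean_space \<Rightarrow> 'b"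
  assumes A: "\<And>k. linear (A k)" "linear A0" "\<And>e. (\<lambda>k. A k e) \<longlonglongrightarrow> A0 e"
    and v: "\<And>k. v k \<in> prox_subdiff h (y k)" and h: "\<And>k. h (y k) = ereal (r k)"
    and y: "y \<longlonglongrightarrow> y0" and r: "r \<longlonglongrightarrow> r0" and h0: "h y0 = ereal r0"
    and lim: "(\<lambda>k. adjoint (A k) (v k)) \<longlonglongrightarrow> 0"
    and trans: "\<And>v. v \<in> horizon_subdiff h y0 \<Longrightarrow> adjoint A0 v = 0 \<Longrightarrow> v = 0"
  shows "\<exists>v\<in>subdiff h y0. adjoint A0 v = 0"
proof -
  txt \<open>The multipliers \<open>v k\<close> may be unbounded, so pass to the limit in the normalized normals; a
    limit with vanishing last component is a horizon subgradient and is excluded by transversality.\<close>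
  define a where "a k = inverse (norm (v k, -1::real))" for k
  have ne: "(v k, -1::real) \<noteq> 0" for k by (simp add: zero_prod_def)
  have apos: "a k > 0" for k unfolding a_def using ne[of k] by simp
  have "1 \<le> norm (v k, -1::real)" for k
    using norm_snd_le[of "-1::real" "v k"] by simp
  then have a1: "a k \<le> 1" for k unfolding a_def by (simp add: inverse_le_1_iff)
  define W where "W k = a k *\<^sub>R (v k, -1::real)" for k
  have W: "norm (W k) = 1" for k
    unfolding W_def a_def using ne[of k] by (simp del: scaleR_Pair)
  obtain w \<rho> where w: "w \<in> sphere 0 1" "strict_mono (\<rho>::nat\<Rightarrow>nat)" "(W \<circ> \<rho>) \<longlonglongrightarrow> w"
    using compact_sphere[of "0 :: 'b \<times> real" 1] W unfolding compact_def by (metis mem_sphere_0)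
  obtain w1 w2 where we: "w = (w1, w2)" by fastforce
  have cone: "w \<in> normal_cone (epi h) (y0, r0)"
    by (rule normal_cone_epi_limit[of "v \<circ> \<rho>" h "y \<circ> \<rho>" "r \<circ> \<rho>" _ _ "a \<circ> \<rho>"])
       (use v h apos w(3) LIMSEQ_subseq_LIMSEQ[OF y w(2)] LIMSEQ_subseq_LIMSEQ[OF r w(2)]
         in \<open>auto simp: W_def comp_def\<close>)
  have lw1: "(\<lambda>k. a (\<rho> k) *\<^sub>R v (\<rho> k)) \<longlonglongrightarrow> w1"
    using tendsto_fst[OF w(3)] by (simp add: we W_def comp_def)
  have "(\<lambda>k. - a (\<rho> k)) \<longlonglongrightarrow> w2"
    using tendsto_snd[OF w(3)] by (simp add: we W_def comp_def)
  then have w2: "w2 \<le> 0"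
    by (rule tendsto_upperbound) (use apos in \<open>auto intro!: always_eventually less_imp_le\<close>)
  \<comment> \<open>Testing against a fixed \<open>e\<close> lets pointwise convergence of the
    operators suffice; the normalizing factors are at most 1 and preserve the convergence to
    0.\<close>
  have "e \<bullet> adjoint A0 w1 = 0" for e
  proof -
    have "(\<lambda>k. A (\<rho> k) e \<bullet> (a (\<rho> k) *\<^sub>R v (\<rho> k))) \<longlonglongrightarrow> A0 e \<bullet> w1"
      using LIMSEQ_subseq_LIMSEQ[OF A(3) w(2), of e] lw1 by (intro tendsto_inner) (auto simp: comp_def)
    moreover have "(\<lambda>k. A (\<rho> k) e \<bullet> (a (\<rho> k) *\<^sub>R v (\<rho> k))) \<longlonglongrightarrow> 0"
    proof (rule Lim_null_comparison)
      show "\<forall>\<^sub>F k in sequentially. norm (A (\<rho> k) e \<bullet> (a (\<rho> k) *\<^sub>R v (\<rho> k)))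
          \<le> norm e * norm (adjoint (A (\<rho> k)) (v (\<rho> k)))"
      proof (intro always_eventually allI)
        fix k
        have "norm (A (\<rho> k) e \<bullet> (a (\<rho> k) *\<^sub>R v (\<rho> k))) = a (\<rho> k) * \<bar>e \<bullet> adjoint (A (\<rho> k)) (v (\<rho> k))\<bar>"
          using apos[of "\<rho> k"] by (simp add: adjoint_works[OF A(1)] abs_mult)
        also have "\<dots> \<le> 1 * (norm e * norm (adjoint (A (\<rho> k)) (v (\<rho> k))))"
          using a1 apos by (intro mult_mono Cauchy_Schwarz_ineq2) (auto intro: less_imp_le)
        finally show "norm (A (\<rho> k) e \<bullet> (a (\<rho> k) *\<^sub>R v (\<rho> k)))
          \<le> norm e * norm (adjoint (A (\<rho> k)) (v (\<rho> k)))" by simp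
      qed
      show "(\<lambda>k. norm e * norm (adjoint (A (\<rho> k)) (v (\<rho> k)))) \<longlonglongrightarrow> 0"
        using tendsto_mult[OF tendsto_const[of "norm e"] tendsto_norm[OF LIMSEQ_subseq_LIMSEQ[OF lim w(2)]]]
        by (simp add: comp_def)
    qed
    ultimately have "A0 e \<bullet> w1 = 0" using LIMSEQ_unique by blast
    then show ?thesis by (simp add: adjoint_works[OF A(2)])
  qed
  then have adj: "adjoint A0 w1 = 0"
    using inner_eq_zero_iff by blast
  have "w2 \<noteq> 0"
  proof
    assume "w2 = 0"
    then have "w1 \<in> horizon_subdiff h y0"
      using cone by (simp add: horizon_subdiff_def we h0)
    then have "w = 0"
      using trans[OF _ adj] by (simp add: we \<open>w2 = 0\<close> zero_prod_def)
    then show False using w(1) by simp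
  qed
  with w2 have "w2 < 0" by simp
  \<comment> \<open>Rescaling makes the last component \<open>-1\<close>, as a subgradient
    demands.\<close>
  then have "inverse (- w2) *\<^sub>R w \<in> normal_cone (epi h) (y0, r0)"
    by (intro normal_cone_scaleR[OF cone]) simp
  then have "inverse (- w2) *\<^sub>R w1 \<in> subdiff h y0"
    using \<open>w2 < 0\<close> by (simp add: subdiff_def h0 we)
  moreover have "adjoint A0 (inverse (- w2) *\<^sub>R w1) = 0"
    unfolding linear_cmul[OF adjoint_linear[OF A(2)]] adj by simp
  ultimately show ?thesis by blast
qed

section \<open>The proximal subproblem near a point\<close>

text \<open>Replaces the choice operator \<open>frechet_derivative\<close> near \<open>z\<close> by
  an operator-valued map, so that continuity in operator norm becomes available.\<close>

lemma C2_near_derivative: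
  fixes c :: "'a::real_normed_vector \<Rightarrow> 'b::real_normed_vector"
  assumes "C2_near c z"
  obtains R f' where "R > 0"
    and "\<And>x. dist x z < R \<Longrightarrow> (c has_derivative blinfun_apply (f' x)) (at x)"
    and "\<And>x d. dist x z < R \<Longrightarrow> linearization c x d = c x + blinfun_apply (f' x) d"
    and "isCont f' z"
proof -
  obtain U f' where U: "open U" "z \<in> U" "\<And>x. x \<in> U \<Longrightarrow> (c has_derivative blinfun_apply (f' x)) (at x)"
      "C1_on U f'"
    using assms unfolding C2_near_def C2_on_def by blast
  obtain R where R: "R > 0" "ball z R \<subseteq> U"
    using U(1,2) open_contains_ball by blast
  have der: "(c has_derivative blinfun_apply (f' x)) (at x)" if "dist x z < R" for x
    using that subsetD[OF R(2), of x] by (intro U(3)) (simp add: dist_commute)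
  moreover have "isCont f' z"
    using U(2,4) has_derivative_continuous unfolding C1_on_def by blast
  ultimately show ?thesis
    using that[of R f'] R(1) frechet_derivative_at[OF der] by (simp add: linearization_def)
qed

text \<open>Estimates uniform in the base point: affine growth in \<open>d\<close>, to be set
  against the quadratic bound on \<open>h\<close>, and closeness to \<open>c z\<close>, which keeps
  arguments where \<open>h\<close> is lower semicontinuous.\<close>

lemma linearization_near:
  fixes c :: "'a::real_normed_vector \<Rightarrow> 'b::real_normed_vector"
  assumes "C2_near c z" and "\<epsilon> > 0"
  obtains \<delta> C where "\<delta> > 0" and "C > 0"
    and "\<And>x d. dist x z < \<delta> \<Longrightarrow> norm (linearization c x d) \<le> C * (1 + norm d)"
    and "\<And>x d. dist x z < \<delta> \<Longrightarrow> norm d < \<delta> \<Longrightarrow> dist (linearization c x d) (c z) < \<epsilon>"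
proof -
  obtain R f' where R: "R > 0"
      "\<And>x. dist x z < R \<Longrightarrow> (c has_derivative blinfun_apply (f' x)) (at x)"
      "\<And>x d. dist x z < R \<Longrightarrow> linearization c x d = c x + blinfun_apply (f' x) d"
      "isCont f' z"
    using C2_near_derivative[OF assms(1)] by blast
  have "isCont c z"
    using has_derivative_continuous[OF R(2)[of z]] R(1) by simp
  then obtain \<delta>1 where \<delta>1: "\<delta>1 > 0" "\<And>x. dist x z < \<delta>1 \<Longrightarrow> dist (c x) (c z) < \<epsilon> / 2"
    using assms(2) unfolding continuous_at_eps_delta
    by (metis half_gt_zero)
  obtain \<delta>2 where \<delta>2: "\<delta>2 > 0" "\<And>x. dist x z < \<delta>2 \<Longrightarrow> dist (f' x) (f' z) < 1"
    using R(4) unfolding continuous_at_eps_delta by (metis zero_less_one)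
  define B where "B = norm (f' z) + 1"
  have B: "B > 0" by (simp add: B_def add_nonneg_pos)
  have f': "norm (blinfun_apply (f' x) d) \<le> B * norm d" if "dist x z < \<delta>2" for x d
  proof -
    have "norm (f' x) \<le> B"
      using \<delta>2(2)[OF that] norm_triangle_ineq2[of "f' x" "f' z"] by (simp add: B_def dist_norm)
    then show ?thesis
      using norm_blinfun[of "f' x" d] mult_right_mono[of "norm (f' x)" B "norm d"] by simp
  qed
  define C where "C = max B (norm (c z) + \<epsilon>)"
  define \<delta> where "\<delta> = min (min R \<delta>1) (min \<delta>2 (\<epsilon> / (2 * B)))"
  have "\<delta> > 0" using R(1) \<delta>1(1) \<delta>2(1) B assms(2) by (simp add: \<delta>_def)
  moreover have "C > 0" using B by (simp add: C_def)
  moreover have "norm (linearization c x d) \<le> C * (1 + norm d)" if x: "dist x z < \<delta>" for x d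
  proof -
    have "norm (c x) \<le> C"
      using \<delta>1(2)[of x] x norm_triangle_ineq2[of "c x" "c z"] assms(2)
      by (simp add: C_def \<delta>_def dist_norm)
    moreover have "norm (blinfun_apply (f' x) d) \<le> C * norm d"
      using f'[of x d] x mult_right_mono[of B C "norm d"] by (simp add: C_def \<delta>_def)
    ultimately show ?thesis
      using R(3)[of x d] x norm_triangle_ineq[of "c x" "blinfun_apply (f' x) d"]
      by (simp add: \<delta>_def algebra_simps)
  qed
  moreover have "dist (linearization c x d) (c z) < \<epsilon>" if x: "dist x z < \<delta>" and d: "norm d < \<delta>" for x d
  proof -
    have "B * norm d < \<epsilon> / 2"
      using d B by (simp add: \<delta>_def field_simps)
    then have "norm (blinfun_apply (f' x) d) < \<epsilon> / 2"
      using f'[of x d] x by (simp add: \<delta>_def)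
    moreover have "norm (c x - c z) < \<epsilon> / 2"
      using \<delta>1(2)[of x] x by (simp add: \<delta>_def dist_norm)
    ultimately show ?thesis
      using R(3)[of x d] x norm_triangle_ineq[of "c x - c z" "blinfun_apply (f' x) d"]
      by (simp add: \<delta>_def dist_norm algebra_simps)
  qed
  ultimately show ?thesis using that by blast
qed

text \<open>By stationarity \<open>\<mu> * norm d\<close> is, up to a small error, the norm of the
  adjoint derivative applied to a subgradient. If it could tend to 0, a limit would be a subgradient
  in the null space, against \<open>noncrit\<close>.\<close>

lemma noncritical_step_bound:
  fixes h :: "'b::euclidean_space \<Rightarrow> ereal" and c :: "'a::euclidean_space \<Rightarrow> 'b"
  assumes C2: "C2_near c z" and fin: "h (c z) = ereal hz" and lsc: "lsc_near h (c z)"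
    and pb: "prox_bounded h" and trans: "transversal h c z"
    and noncrit: "subdiff h (c z) \<inter> null_adjoint_deriv c z = {}"
  obtains \<kappa> \<delta> where "\<kappa> > 0" and "\<delta> > 0"
    and "\<And>x d \<mu> l. dist x z < \<delta> \<Longrightarrow> norm d < \<delta> \<Longrightarrow> \<mu> \<ge> 0 \<Longrightarrow>
      h (linearization c x d) = ereal l \<Longrightarrow> \<bar>l - hz\<bar> < \<delta> \<Longrightarrow>
      local_minimizer (prox_lin h c x \<mu>) d \<Longrightarrow> \<kappa> \<le> \<mu> * norm d"
proof (rule ccontr)
  assume not_thesis: "\<not> thesis"
  obtain R f' where R: "R > 0"
      "\<And>x. dist x z < R \<Longrightarrow> (c has_derivative blinfun_apply (f' x)) (at x)"
      "\<And>x d. dist x z < R \<Longrightarrow> linearization c x d = c x + blinfun_apply (f' x) d"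
      "isCont f' z"
    using C2_near_derivative[OF C2] by blast
  obtain R' where R': "R' > 0" "\<And>y. y \<in> ball (c z) R' \<Longrightarrow> lsc_at h y"
    using lsc_near_imp_lsc_at_ball[OF lsc] by blast
  obtain \<delta>0 where \<delta>0: "\<delta>0 > 0"
      "\<And>x d. dist x z < \<delta>0 \<Longrightarrow> norm d < \<delta>0 \<Longrightarrow> dist (linearization c x d) (c z) < R' / 2"
    using linearization_near[OF C2, of "R' / 2"] R'(1) by (metis half_gt_zero)
  \<comment> \<open>One null sequence serves as both \<kappa> and \<delta> in the negated claim; the
    caps \<open>R\<close> and \<open>\<delta>0\<close> keep all terms where the local estimates
    hold.\<close>
  define \<eta> where "\<eta> n = min (min R \<delta>0) (inverse (real (Suc n)))" for n
  have \<eta>: "\<eta> n > 0" for n using R(1) \<delta>0(1) by (simp add: \<eta>_def)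
  have "\<exists>x d \<mu> l. dist x z < \<eta> n \<and> norm d < \<eta> n \<and> \<mu> \<ge> 0 \<and> h (linearization c x d) = ereal l \<and>
      \<bar>l - hz\<bar> < \<eta> n \<and> local_minimizer (prox_lin h c x \<mu>) d \<and> \<mu> * norm d < \<eta> n" for n
    using not_thesis that[OF \<eta>[of n] \<eta>[of n]] by (metis not_le)
  then obtain X D M L where S:
      "\<And>n. dist (X n) z < \<eta> n" "\<And>n. norm (D n) < \<eta> n" "\<And>n. M n \<ge> 0"
      "\<And>n. h (linearization c (X n) (D n)) = ereal (L n)" "\<And>n. \<bar>L n - hz\<bar> < \<eta> n"
      "\<And>n. local_minimizer (prox_lin h c (X n) (M n)) (D n)" "\<And>n. M n * norm (D n) < \<eta> n"
    by metis
  have \<eta>_lim: "\<eta> \<longlonglongrightarrow> 0"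
    by (rule Lim_null_comparison[OF _ LIMSEQ_inverse_real_of_nat])
       (use \<eta> in \<open>auto simp: \<eta>_def intro!: always_eventually\<close>)
  have null: "g \<longlonglongrightarrow> 0" if "\<And>n. norm (g n) \<le> \<eta> n" for g :: "nat \<Rightarrow> 'c::real_normed_vector"
    using that by (intro Lim_null_comparison[OF _ \<eta>_lim]) auto
  have XR: "dist (X n) z < R" and near: "dist (linearization c (X n) (D n)) (c z) < R' / 2" for n
    using S(1,2)[of n] \<delta>0(2)[of "X n" "D n"] by (auto simp: \<eta>_def)
  have lin: "linearization c (X n) d = c (X n) + blinfun_apply (f' (X n)) d" for n d
    using R(3)[OF XR] .
  \<comment> \<open>The fuzzy rule is applied with error \<open>\<eta> n\<close> on a ball of radius
    \<open>R' / 3\<close>. Its centre is within \<open>R' / 2\<close> of \<open>c z\<close>, so the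
    ball stays in the region of lower semicontinuity.\<close>
  have "\<exists>y r v. dist y (linearization c (X n) (D n)) < \<eta> n \<and> h y = ereal r \<and> \<bar>r - L n\<bar> < \<eta> n \<and>
      v \<in> prox_subdiff h y \<and> norm (adjoint (blinfun_apply (f' (X n))) v + M n *\<^sub>R D n) < \<eta> n" for n
  proof (rule prox_subdiff_near_local_minimizer[where h = h and \<mu> = "M n" and b = "c (X n)"
        and A = "blinfun_apply (f' (X n))" and R = "R' / 3" and ?d0.0 = "D n" and ?r0.0 = "L n" and \<epsilon> = "\<eta> n"])
    show "linear (blinfun_apply (f' (X n)))"
      using blinfun.bounded_linear_right bounded_linear.linear by blast
    show "lsc_at h y" if "y \<in> cball (c (X n) + blinfun_apply (f' (X n)) (D n)) (R' / 3)" for y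
    proof (rule R'(2))
      have "dist (linearization c (X n) (D n)) y \<le> R' / 3" using that by (simp add: lin)
      then show "y \<in> ball (c z) R'"
        using near[of n] R'(1) dist_triangle3[of "c z" y "linearization c (X n) (D n)"] by simp
    qed
    show "local_minimizer (\<lambda>d. h (c (X n) + blinfun_apply (f' (X n)) d) + ereal (M n / 2 * (norm d)\<^sup>2)) (D n)"
      using S(6)[of n] by (simp add: prox_lin_def[abs_def] lin)
  qed (use pb S(3,4)[of n] R'(1) \<eta> lin in auto)
  then obtain Y r v where P: "\<And>n. dist (Y n) (linearization c (X n) (D n)) < \<eta> n"
      "\<And>n. h (Y n) = ereal (r n)" "\<And>n. \<bar>r n - L n\<bar> < \<eta> n" "\<And>n. v n \<in> prox_subdiff h (Y n)"
      "\<And>n. norm (adjoint (blinfun_apply (f' (X n))) (v n) + M n *\<^sub>R D n) < \<eta> n"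
    by metis
  have "(\<lambda>n. X n - z) \<longlonglongrightarrow> 0" by (rule null) (use S(1) in \<open>auto simp: dist_norm less_imp_le\<close>)
  then have Xz: "X \<longlonglongrightarrow> z" using LIM_zero_cancel by blast
  have Dz: "D \<longlonglongrightarrow> 0" by (rule null) (use S(2) in \<open>auto simp: less_imp_le\<close>)
  have f'X: "(\<lambda>n. f' (X n)) \<longlonglongrightarrow> f' z"
    using isCont_tendsto_compose[OF R(4) Xz] .
  have "isCont c z" using has_derivative_continuous[OF R(2)[of z]] R(1) by simp
  then have "(\<lambda>n. c (X n)) \<longlonglongrightarrow> c z"
    using isCont_tendsto_compose Xz by blast
  then have "(\<lambda>n. c (X n) + blinfun_apply (f' (X n)) (D n)) \<longlonglongrightarrow> c z + blinfun_apply (f' z) 0"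
    by (intro tendsto_intros f'X Dz)
  then have "(\<lambda>n. linearization c (X n) (D n)) \<longlonglongrightarrow> c z" by (simp add: lin)
  moreover have "(\<lambda>n. Y n - linearization c (X n) (D n)) \<longlonglongrightarrow> 0"
    by (rule null) (use P(1) in \<open>auto simp: dist_norm less_imp_le\<close>)
  ultimately have Yz: "Y \<longlonglongrightarrow> c z" using tendsto_add by fastforce
  have "(\<lambda>n. r n - L n) \<longlonglongrightarrow> 0" "(\<lambda>n. L n - hz) \<longlonglongrightarrow> 0"
    by (rule null; use P(3) S(5) in \<open>auto simp: less_imp_le\<close>)+
  then have rz: "r \<longlonglongrightarrow> hz" using tendsto_add LIM_zero_cancel by fastforce
  \<comment> \<open>Here the negated bound enters: the proximal term drops out of stationarity
    although \<open>M n\<close> itself may be unbounded.\<close>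
  have "(\<lambda>n. M n *\<^sub>R D n) \<longlonglongrightarrow> 0"
    by (rule null) (use S(3,7) in \<open>auto simp: less_imp_le\<close>)
  moreover have "(\<lambda>n. adjoint (blinfun_apply (f' (X n))) (v n) + M n *\<^sub>R D n) \<longlonglongrightarrow> 0"
    by (rule null) (use P(5) in \<open>auto simp: less_imp_le\<close>)
  ultimately have adj: "(\<lambda>n. adjoint (blinfun_apply (f' (X n))) (v n)) \<longlonglongrightarrow> 0"
    using tendsto_diff by fastforce
  have Dc: "frechet_derivative c (at z) = blinfun_apply (f' z)"
    using frechet_derivative_at[OF R(2)[of z]] R(1) by simp
  have "\<exists>v\<in>subdiff h (c z). adjoint (blinfun_apply (f' z)) v = 0"
  proof (rule subdiff_kernel_limit[where A = "\<lambda>n. blinfun_apply (f' (X n))", OF _ _ _ P(4,2) Yz rz fin adj])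
    show "linear (blinfun_apply (f' (X n)))" "linear (blinfun_apply (f' z))" for n
      using blinfun.bounded_linear_right bounded_linear.linear by blast+
    show "(\<lambda>n. blinfun_apply (f' (X n)) e) \<longlonglongrightarrow> blinfun_apply (f' z) e" for e
      by (intro tendsto_intros f'X)
    show "v = 0" if "v \<in> horizon_subdiff h (c z)" "adjoint (blinfun_apply (f' z)) v = 0" for v
      using trans that unfolding transversal_def null_adjoint_deriv_def Dc by blast
  qed
  then show False
    using noncrit unfolding null_adjoint_deriv_def Dc by blast
qed

text \<open>A large \<mu> outweighs the quadratic decay allowed by prox-boundedness, so a
  \<open>d\<close> no worse than 0 is short. Its value of \<open>h\<close> is then pinched between
  lower semicontinuity at \<open>c z\<close> and the value at \<open>c x\<close>.\<close>

lemma prox_lin_decrease_near: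
  fixes h :: "'b::euclidean_space \<Rightarrow> ereal" and c :: "'a::euclidean_space \<Rightarrow> 'b"
  assumes C2: "C2_near c z" and fin: "h (c z) = ereal hz" and lsc: "lsc_near h (c z)"
    and pb: "prox_bounded h" and \<epsilon>: "\<epsilon> > 0"
  obtains \<delta> M where "\<delta> > 0"
    and "\<And>x \<mu> d. dist x z < \<delta> \<Longrightarrow> \<mu> \<ge> M \<Longrightarrow> h (c x) < ereal (hz + \<delta>) \<Longrightarrow>
      prox_lin h c x \<mu> d \<le> h (c x) \<Longrightarrow>
      norm d < \<epsilon> \<and> \<bar>h (linearization c x d) - ereal hz\<bar> < ereal \<epsilon>"
proof -
  have "lsc_at h (c z)"
    using lsc_near_imp_lsc_at_ball[OF lsc] by (metis centre_in_ball)
  then have "\<forall>\<^sub>F y in nhds (c z). ereal (hz - \<epsilon>) < h y"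
    using fin \<epsilon> by (simp add: lsc_at_def)
  then obtain \<rho> where \<rho>: "\<rho> > 0" "\<And>y. dist y (c z) < \<rho> \<Longrightarrow> ereal (hz - \<epsilon>) < h y"
    unfolding eventually_nhds_metric by auto
  obtain \<delta>0 C where \<delta>0: "\<delta>0 > 0" "C > 0"
      "\<And>x d. dist x z < \<delta>0 \<Longrightarrow> norm (linearization c x d) \<le> C * (1 + norm d)"
      "\<And>x d. dist x z < \<delta>0 \<Longrightarrow> norm d < \<delta>0 \<Longrightarrow> dist (linearization c x d) (c z) < \<rho>"
    using linearization_near[OF C2 \<rho>(1)] by metis
  obtain h0 q0 where q: "q0 \<ge> 0" "\<And>y. ereal (h0 - q0 * (norm y)\<^sup>2) \<le> h y"
    using pb unfolding prox_bounded_def by auto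
  define Q where "Q = 2 * q0 * C\<^sup>2"
  define B where "B = \<bar>hz + 1 - h0 + Q\<bar> + 1"
  define \<epsilon>1 where "\<epsilon>1 = min \<epsilon> \<delta>0"
  define \<delta> where "\<delta> = min \<delta>0 (min 1 \<epsilon>)"
  define W where "W = Q + B / \<epsilon>1\<^sup>2"
  define M where "M = 2 * W"
  have pos: "\<epsilon>1 > 0" "\<delta> > 0" "B > 0"
    using \<epsilon> \<delta>0(1) by (auto simp: \<epsilon>1_def \<delta>_def B_def)
  have "norm d < \<epsilon> \<and> \<bar>h (linearization c x d) - ereal hz\<bar> < ereal \<epsilon>"
    if x: "dist x z < \<delta>" and \<mu>: "\<mu> \<ge> M" and hx: "h (c x) < ereal (hz + \<delta>)"
      and d: "prox_lin h c x \<mu> d \<le> h (c x)" for x \<mu> d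
  proof -
    have le: "h (linearization c x d) + ereal (\<mu> / 2 * (norm d)\<^sup>2) < ereal (hz + \<delta>)"
      using d hx unfolding prox_lin_def by order
    moreover have "ereal (h0 - q0 * (norm (linearization c x d))\<^sup>2) \<le> h (linearization c x d)"
      using q(2) .
    ultimately obtain l where l: "h (linearization c x d) = ereal l"
      by (cases "h (linearization c x d)") auto
    have l1: "l + \<mu> / 2 * (norm d)\<^sup>2 < hz + \<delta>"
      using le l by simp
    have "(norm (linearization c x d))\<^sup>2 \<le> (C * (1 + norm d))\<^sup>2"
      using \<delta>0(3)[of x d] x by (intro power_mono) (auto simp: \<delta>_def)
    also have "\<dots> \<le> C\<^sup>2 * (2 * (1 + (norm d)\<^sup>2))"
      unfolding power_mult_distrib
      using sum_squares_bound[of 1 "norm d"] by (intro mult_left_mono) (auto simp: power2_sum)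
    finally have "q0 * (norm (linearization c x d))\<^sup>2 \<le> q0 * (C\<^sup>2 * (2 * (1 + (norm d)\<^sup>2)))"
      using q(1) by (intro mult_left_mono)
    then have "q0 * (norm (linearization c x d))\<^sup>2 \<le> Q + Q * (norm d)\<^sup>2"
      by (simp add: Q_def algebra_simps)
    moreover have "h0 - q0 * (norm (linearization c x d))\<^sup>2 \<le> l"
      using q(2)[of "linearization c x d"] l by simp
    moreover have "W * (norm d)\<^sup>2 \<le> \<mu> / 2 * (norm d)\<^sup>2"
      using \<mu> by (intro mult_right_mono) (auto simp: M_def)
    moreover have "W * (norm d)\<^sup>2 = Q * (norm d)\<^sup>2 + B / \<epsilon>1\<^sup>2 * (norm d)\<^sup>2"
      unfolding W_def by (rule distrib_right)
    ultimately have "h0 - Q + B / \<epsilon>1\<^sup>2 * (norm d)\<^sup>2 < hz + \<delta>"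
      using l1 by linarith
    then have "B / \<epsilon>1\<^sup>2 * (norm d)\<^sup>2 < B"
      by (simp add: B_def \<delta>_def)
    then have "(norm d)\<^sup>2 < \<epsilon>1\<^sup>2"
      using pos by (simp add: field_simps)
    then have nd: "norm d < \<epsilon>1"
      using pos(1) by (meson less_imp_le power2_less_imp_less)
    have "dist (linearization c x d) (c z) < \<rho>"
      using nd x by (intro \<delta>0(4)) (auto simp: \<epsilon>1_def \<delta>_def)
    then have "hz - \<epsilon> < l"
      using \<rho>(2) l by force
    moreover have "l < hz + \<epsilon>"
    proof -
      have "B / \<epsilon>1\<^sup>2 \<ge> 0" "Q \<ge> 0" using pos q(1) by (auto simp: Q_def)
      then have "\<mu> / 2 * (norm d)\<^sup>2 \<ge> 0" using \<mu> by (simp add: M_def W_def)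
      then show ?thesis using l1 by (simp add: \<delta>_def)
    qed
    ultimately show ?thesis
      using nd l by (simp add: \<epsilon>1_def abs_less_iff)
  qed
  then show ?thesis using that[OF pos(2)] by blast
qed

lemma prox_step_exists_near:
  fixes h :: "'b::euclidean_space \<Rightarrow> ereal" and c :: "'a::euclidean_space \<Rightarrow> 'b"
  assumes C2: "C2_near c z" and fin: "h (c z) = ereal hz" and lsc: "lsc_near h (c z)"
    and pb: "prox_bounded h"
  obtains \<delta> M where "\<delta> > 0"
    and "\<And>x \<mu>. dist x z < \<delta> \<Longrightarrow> \<mu> \<ge> M \<Longrightarrow> h (c x) < ereal (hz + \<delta>) \<Longrightarrow>
      \<not> local_minimizer (prox_lin h c x \<mu>) 0 \<Longrightarrow> \<exists>d. prox_step h c x \<mu> d"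
proof -
  obtain R f' where R: "R > 0"
      "\<And>x. dist x z < R \<Longrightarrow> (c has_derivative blinfun_apply (f' x)) (at x)"
      "\<And>x d. dist x z < R \<Longrightarrow> linearization c x d = c x + blinfun_apply (f' x) d"
    using C2_near_derivative[OF C2] by metis
  obtain R' where R': "R' > 0" "\<And>y. y \<in> ball (c z) R' \<Longrightarrow> lsc_at h y"
    using lsc_near_imp_lsc_at_ball[OF lsc] by blast
  obtain \<delta>0 where \<delta>0: "\<delta>0 > 0"
      "\<And>x d. dist x z < \<delta>0 \<Longrightarrow> norm d < \<delta>0 \<Longrightarrow> dist (linearization c x d) (c z) < R'"
    using linearization_near[OF C2 R'(1)] by metis
  define \<epsilon> where "\<epsilon> = \<delta>0 / 2"
  have \<epsilon>: "\<epsilon> > 0" using \<delta>0(1) by (simp add: \<epsilon>_def)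
  obtain \<delta>1 M where \<delta>1: "\<delta>1 > 0"
      "\<And>x \<mu> d. dist x z < \<delta>1 \<Longrightarrow> \<mu> \<ge> M \<Longrightarrow> h (c x) < ereal (hz + \<delta>1) \<Longrightarrow>
        prox_lin h c x \<mu> d \<le> h (c x) \<Longrightarrow> norm d < \<epsilon>"
    using prox_lin_decrease_near[OF C2 fin lsc pb \<epsilon>] by metis
  define \<delta> where "\<delta> = min R (min \<delta>0 \<delta>1)"
  have "\<exists>d. prox_step h c x \<mu> d"
    if x: "dist x z < \<delta>" and \<mu>: "\<mu> \<ge> M" and hx: "h (c x) < ereal (hz + \<delta>)"
      and nloc: "\<not> local_minimizer (prox_lin h c x \<mu>) 0" for x \<mu>
  proof -
    have lin: "linearization c x d = c x + blinfun_apply (f' x) d" for d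
      using R(3) x by (simp add: \<delta>_def)
    have zero: "prox_lin h c x \<mu> 0 = h (c x)"
      by (simp add: prox_lin_def lin)
    have "lsc_at (\<lambda>d. h (c x + blinfun_apply (f' x) d) + ereal (\<mu> / 2 * (norm d)\<^sup>2)) d"
      if d: "d \<in> cball 0 \<epsilon>" for d
    proof (rule lsc_at_add_real)
      have "dist (linearization c x d) (c z) < R'"
        using d x \<epsilon> by (intro \<delta>0(2)) (auto simp: \<epsilon>_def \<delta>_def)
      then have "lsc_at h (c x + blinfun_apply (f' x) d)"
        using R'(2) by (simp add: lin dist_commute)
      then show "lsc_at (\<lambda>d. h (c x + blinfun_apply (f' x) d)) d"
        by (rule lsc_at_compose) (intro continuous_intros)
      show "isCont (\<lambda>d. \<mu> / 2 * (norm d)\<^sup>2) d"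
        by (intro continuous_intros)
    qed
    then have "\<exists>d\<in>cball 0 \<epsilon>. \<forall>d'\<in>cball 0 \<epsilon>. prox_lin h c x \<mu> d \<le> prox_lin h c x \<mu> d'"
      unfolding prox_lin_def lin using \<epsilon> by (intro lsc_attains_min) auto
    then obtain d where d: "d \<in> cball 0 \<epsilon>"
        "\<And>d'. d' \<in> cball 0 \<epsilon> \<Longrightarrow> prox_lin h c x \<mu> d \<le> prox_lin h c x \<mu> d'"
      by blast
    have loc: "local_minimizer (prox_lin h c x \<mu>) e"
      if "norm e < \<epsilon>" "prox_lin h c x \<mu> e \<le> prox_lin h c x \<mu> d" for e
    proof -
      have "\<forall>\<^sub>F y in nhds e. y \<in> ball 0 \<epsilon>"
        using that(1) by (intro eventually_nhds_in_open) auto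
      then show ?thesis
        unfolding local_minimizer_def
        by eventually_elim (use d(2) that(2) in \<open>auto intro: order.trans less_imp_le\<close>)
    qed
    have "prox_lin h c x \<mu> d \<le> prox_lin h c x \<mu> 0"
      using d(2)[of 0] \<epsilon> by simp
    moreover have "norm d < \<epsilon>"
      using calculation x \<mu> hx unfolding zero
      by (intro \<delta>1(2)[of x \<mu> d]) (auto simp: \<delta>_def elim!: less_le_trans)
    moreover have "\<not> prox_lin h c x \<mu> 0 \<le> prox_lin h c x \<mu> d"
      using nloc loc[of 0] \<epsilon> by auto
    ultimately show ?thesis
      unfolding prox_step_def using loc[of d] by (intro exI[of _ d]) auto
  qed
  moreover have "\<delta> > 0" using R(1) \<delta>0(1) \<delta>1(1) by (simp add: \<delta>_def)
  ultimately show ?thesis using that by blast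
qed

section \<open>Convergence of ProxDescent\<close>

lemma linearization_zero:
  assumes "C1_on UNIV c"
  shows "linearization c x 0 = c x"
proof -
  have "c differentiable (at x)"
    using assms unfolding C1_on_def differentiable_def by blast
  then show ?thesis
    using linear_frechet_derivative linear_0 unfolding linearization_def by fastforce
qed

lemma prox_bounded_not_MInf:
  assumes "prox_bounded h"
  shows "h y \<noteq> -\<infinity>"
proof -
  obtain h0 q0 where "ereal (h0 - q0 * (norm y)\<^sup>2) \<le> h y"
    using assms unfolding prox_bounded_def by blast
  then show ?thesis by auto
qed

lemma prox_step_finite:
  assumes "prox_step h c x \<mu> d" and "prox_bounded h" and "linearization c x 0 = c x"
    and "h (c x) = ereal H"
  obtains l where "h (linearization c x d) = ereal l" and "l + \<mu> / 2 * (norm d)\<^sup>2 < H"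
proof -
  have "h (linearization c x d) + ereal (\<mu> / 2 * (norm d)\<^sup>2) < ereal H"
    using assms by (simp add: prox_step_def prox_lin_def)
  then show ?thesis
    using prox_bounded_not_MInf[OF assms(2), of "linearization c x d"] that
    by (cases "h (linearization c x d)") auto
qed

lemma acceptable_finite:
  assumes "acceptable h c \<sigma> x d p" and "prox_bounded h"
    and "h (c x) = ereal H" and "h (linearization c x d) = ereal l"
  obtains H' where "h (c p) = ereal H'" and "\<sigma> * (H - l) \<le> H - H'"
proof -
  have "ereal (\<sigma> * (H - l)) \<le> ereal H - h (c p)"
    using assms by (simp add: acceptable_def)
  then show ?thesis
    using prox_bounded_not_MInf[OF assms(2), of "c p"] that
    by (cases "h (c p)") auto
qed

lemma acceptable_if_large_mu:
  assumes hx: "h (c x) = ereal H" and l: "h (linearization c x d) = ereal l"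
    and dec: "l + \<mu> / 2 * (norm d)\<^sup>2 < H"
    and hp: "h (c p) \<le> h (linearization c x d) + ereal (\<gamma> * (norm d)\<^sup>2)"
    and p: "norm (p - (x + d)) \<le> \<gamma> * (norm d)\<^sup>2"
    and \<gamma>: "\<gamma> * norm d \<le> 1 / 2" and \<sigma>: "\<sigma> < 1" and \<mu>: "2 * \<gamma> / (1 - \<sigma>) \<le> \<mu>"
    and pb: "prox_bounded h"
  shows "acceptable h c \<sigma> x d p"
proof -
  have "h (c p) \<le> ereal (l + \<gamma> * (norm d)\<^sup>2)" using hp l by simp
  then obtain H' where H': "h (c p) = ereal H'" "H' \<le> l + \<gamma> * (norm d)\<^sup>2"
    using prox_bounded_not_MInf[OF pb, of "c p"] by (cases "h (c p)") auto
  have "\<gamma> \<le> (1 - \<sigma>) * (\<mu> / 2)"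
    using \<mu> \<sigma> by (simp add: field_simps)
  then have "\<gamma> * (norm d)\<^sup>2 \<le> (1 - \<sigma>) * (\<mu> / 2) * (norm d)\<^sup>2"
    by (intro mult_right_mono) auto
  also have "\<dots> = (1 - \<sigma>) * (\<mu> / 2 * (norm d)\<^sup>2)" by simp
  also have "\<dots> \<le> (1 - \<sigma>) * (H - l)"
    using dec \<sigma> by (intro mult_left_mono) auto
  finally have "\<sigma> * (H - l) \<le> H - H'"
    using H'(2) by (simp add: algebra_simps)
  moreover have "norm (p - (x + d)) \<le> 1 / 2 * norm d"
    using p mult_right_mono[OF \<gamma>, of "norm d"] by (simp add: power2_eq_square)
  ultimately show ?thesis
    by (simp add: acceptable_def hx l H'(1))
qed

lemma ProxDescent_run_values:
  fixes h :: "'b::real_normed_vector \<Rightarrow> ereal" and c :: "'a::real_normed_vector \<Rightarrow> 'b"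
  assumes run: "ProxDescent_run h c \<tau> \<sigma> \<mu>min x J \<mu> d p"
    and pb: "prox_bounded h" and C1: "C1_on UNIV c"
  obtains H L where "\<And>k. h (c (x k)) = ereal (H k)"
    and "\<And>k. h (linearization c (x k) (d k (J k))) = ereal (L k)"
    and "\<And>k. L k + \<mu> k (J k) / 2 * (norm (d k (J k)))\<^sup>2 < H k"
    and "\<And>k. \<sigma> * (H k - L k) \<le> H k - H (Suc k)"
proof -
  have step: "prox_step h c (x k) (\<mu> k (J k)) (d k (J k))"
      "acceptable h c \<sigma> (x k) (d k (J k)) (x (Suc k))" for k
    using run unfolding ProxDescent_run_def by auto
  have "\<exists>r. h (c (x k)) = ereal r" for k
  proof (induction k)
    case 0
    then show ?case using run unfolding ProxDescent_run_def by (cases "h (c (x 0))") auto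
  next
    case (Suc k)
    then obtain r where r: "h (c (x k)) = ereal r" by blast
    then show ?case
      using prox_step_finite[OF step(1) pb linearization_zero[OF C1] r]
        acceptable_finite[OF step(2) pb r] by metis
  qed
  then obtain H where H: "\<And>k. h (c (x k)) = ereal (H k)" by metis
  have "\<exists>l. h (linearization c (x k) (d k (J k))) = ereal l \<and>
      l + \<mu> k (J k) / 2 * (norm (d k (J k)))\<^sup>2 < H k" for k
    using prox_step_finite[OF step(1) pb linearization_zero[OF C1] H] by blast
  then obtain L where L: "\<And>k. h (linearization c (x k) (d k (J k))) = ereal (L k)"
      "\<And>k. L k + \<mu> k (J k) / 2 * (norm (d k (J k)))\<^sup>2 < H k"
    by metis
  have "\<sigma> * (H k - L k) \<le> H k - H (Suc k)" for k
    using acceptable_finite[OF step(2)[of k] pb H L(1)] H[of "Suc k"] by fastforce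
  then show ?thesis using that H L by blast
qed

lemma ProxDescent_run_mu_ge:
  assumes run: "ProxDescent_run h c \<tau> \<sigma> \<mu>min x J \<mu> d p" and "\<tau> > 1" and "\<mu>min > 0"
    and "i \<le> J k"
  shows "\<mu> k i \<ge> \<mu>min"
  using assms(4)
proof (induction i)
  case 0
  show ?case using run unfolding ProxDescent_run_def by (cases k) auto
next
  case (Suc i)
  then have "\<mu> k (Suc i) = \<tau> * \<mu> k i" "\<mu> k i \<ge> \<mu>min"
    using run unfolding ProxDescent_run_def by auto
  then show ?case
    using mult_mono[of 1 \<tau> \<mu>min "\<mu> k i"] assms(2,3) by simp
qed

theorem theorem5p4:
  fixes h :: "real ^ 'm \<Rightarrow> ereal"
    and c :: "real ^ 'n \<Rightarrow> real ^ 'm"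
    and \<tau> \<sigma> \<mu>min :: real
    and x :: "nat \<Rightarrow> real ^ 'n"
    and J :: "nat \<Rightarrow> nat"
    and \<mu> :: "nat \<Rightarrow> nat \<Rightarrow> real"
    and d p :: "nat \<Rightarrow> nat \<Rightarrow> real ^ 'n"
    and xbar :: "real ^ 'n"
  assumes "\<tau> > 1" and "0 < \<sigma>" and "\<sigma> < 1" and "\<mu>min > 0"
    and "C1_on UNIV c"
    and "ProxDescent_run h c \<tau> \<sigma> \<mu>min x J \<mu> d p"
    and "efficient_projection h c x J \<mu> d p"
    and "\<exists>r :: nat \<Rightarrow> nat. strict_mono r \<and>
           (\<lambda>j. (x (r j), h (c (x (r j))))) \<longlonglongrightarrow> (xbar, h (c xbar))"
    and "C2_near c xbar"
    and "subdiff_regular h (c xbar)"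
    and "prox_bounded h"
    and "horizon_subdiff h (c xbar) \<inter> null_adjoint_deriv c xbar = {0}"
  shows "\<exists>vbar. vbar \<in> subdiff h (c xbar) \<inter> null_adjoint_deriv c xbar"
proof (rule ccontr)
  note run = assms(6) and C2 = assms(9) and pb = assms(11)
  assume "\<not> ?thesis"
  then have noncrit: "subdiff h (c xbar) \<inter> null_adjoint_deriv c xbar = {}" by blast
  have trans: "transversal h c xbar" using assms(12) by (simp add: transversal_def)
  have lsc: "lsc_near h (c xbar)" using assms(10) by (simp add: subdiff_regular_def)
  obtain hz where hz: "h (c xbar) = ereal hz"
    using assms(10) unfolding subdiff_regular_def by (cases "h (c xbar)") auto
  obtain r where r: "strict_mono r" "(\<lambda>j. x (r j)) \<longlonglongrightarrow> xbar"
      "(\<lambda>j. h (c (x (r j)))) \<longlonglongrightarrow> ereal hz"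
    using assms(8) hz tendsto_fst tendsto_snd by fastforce
  obtain H L where HL: "\<And>k. h (c (x k)) = ereal (H k)"
      "\<And>k. h (linearization c (x k) (d k (J k))) = ereal (L k)"
      "\<And>k. L k + \<mu> k (J k) / 2 * (norm (d k (J k)))\<^sup>2 < H k"
      "\<And>k. \<sigma> * (H k - L k) \<le> H k - H (Suc k)"
    using ProxDescent_run_values[OF run pb assms(5)] by metis
  define M D where "M = (\<lambda>k. \<mu> k (J k))" and "D = (\<lambda>k. d k (J k))"
  note mu_ge = ProxDescent_run_mu_ge[OF run assms(1,4)]
  have M: "M k \<ge> \<mu>min" for k unfolding M_def by (rule mu_ge) simp
  have M0: "M k > 0" for k using M[of k] assms(4) by simp
  have dec: "L k + M k / 2 * (norm (D k))\<^sup>2 < H k" for k using HL(3) by (simp add: M_def D_def)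
  have "M k / 2 * (norm (D k))\<^sup>2 \<ge> 0" for k using M0[of k] by simp
  then have LH: "L k < H k" for k using dec[of k] by (smt (verit))
  have "H (Suc k) \<le> H k" for k
    using HL(4)[of k] mult_pos_pos[OF assms(2), of "H k - L k"] LH[of k] by linarith
  then have decH: "decseq H" by (simp add: decseq_Suc_iff)
  have Hr: "(\<lambda>j. H (r j)) \<longlonglongrightarrow> hz" using r(3) by (simp add: HL(1))
  have Hge: "hz \<le> H k" for k
  proof (rule tendsto_upperbound[OF Hr])
    show "\<forall>\<^sub>F j in sequentially. H (r j) \<le> H k"
      using seq_suble[OF r(1)]
      by (intro eventually_sequentiallyI[of k] decseqD[OF decH]) (rule order.trans)
  qed simp
  obtain Hinf where "H \<longlonglongrightarrow> Hinf" using decseq_convergent[OF decH] Hge by blast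
  then have Hlim: "H \<longlonglongrightarrow> hz"
    using LIMSEQ_subseq_LIMSEQ[OF _ r(1)] Hr LIMSEQ_unique unfolding comp_def by blast
  have Llim: "L \<longlonglongrightarrow> hz"
  proof (rule tendsto_sandwich)
    have "(\<lambda>k. H k - (H k - H (Suc k)) / \<sigma>) \<longlonglongrightarrow> hz - (hz - hz) / \<sigma>"
      using assms(2) by (intro tendsto_intros Hlim LIMSEQ_Suc) auto
    then show "(\<lambda>k. H k - (H k - H (Suc k)) / \<sigma>) \<longlonglongrightarrow> hz" by simp
    have "H k - (H k - H (Suc k)) / \<sigma> \<le> L k" for k
      using HL(4)[of k] assms(2) by (simp add: field_simps)
    then show "\<forall>\<^sub>F k in sequentially. H k - (H k - H (Suc k)) / \<sigma> \<le> L k" by simp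
    show "\<forall>\<^sub>F k in sequentially. L k \<le> H k" using LH by (simp add: less_imp_le)
  qed (rule Hlim)
  have Dlim: "D \<longlonglongrightarrow> 0"
  proof -
    have "norm ((norm (D k))\<^sup>2) \<le> 2 / \<mu>min * (H k - L k)" for k
    proof -
      have "\<mu>min / 2 * (norm (D k))\<^sup>2 \<le> M k / 2 * (norm (D k))\<^sup>2"
        using M[of k] by (intro mult_right_mono) auto
      then have "\<mu>min / 2 * (norm (D k))\<^sup>2 \<le> H k - L k" using dec[of k] by simp
      then show ?thesis using assms(4) by (simp add: field_simps)
    qed
    moreover have "(\<lambda>k. 2 / \<mu>min * (H k - L k)) \<longlonglongrightarrow> 2 / \<mu>min * (hz - hz)"
      by (intro tendsto_intros Hlim Llim)
    ultimately have "(\<lambda>k. (norm (D k))\<^sup>2) \<longlonglongrightarrow> 0"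
      by (intro Lim_null_comparison[of "\<lambda>k. (norm (D k))\<^sup>2" "\<lambda>k. 2 / \<mu>min * (H k - L k)"]) auto
    from tendsto_real_sqrt[OF this] show ?thesis
      by (simp add: tendsto_norm_zero_iff)
  qed
  have xstep: "dist (x (Suc k)) (x k) \<le> 3 / 2 * norm (D k)" for k
  proof -
    have "norm (x (Suc k) - (x k + D k)) \<le> 1 / 2 * norm (D k)"
      using run unfolding ProxDescent_run_def acceptable_def D_def by simp
    then show ?thesis
      using norm_triangle_ineq[of "x (Suc k) - (x k + D k)" "D k"] by (simp add: dist_norm)
  qed

  obtain \<kappa> \<delta>1 where \<kappa>: "\<kappa> > 0" "\<delta>1 > 0"
      "\<And>x d \<mu> l. dist x xbar < \<delta>1 \<Longrightarrow> norm d < \<delta>1 \<Longrightarrow> \<mu> \<ge> 0 \<Longrightarrow>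
        h (linearization c x d) = ereal l \<Longrightarrow> \<bar>l - hz\<bar> < \<delta>1 \<Longrightarrow>
        local_minimizer (prox_lin h c x \<mu>) d \<Longrightarrow> \<kappa> \<le> \<mu> * norm d"
    using noncritical_step_bound[OF C2 hz lsc pb trans noncrit] by metis
  have "\<bar>h (c xbar)\<bar> \<noteq> \<infinity>" by (simp add: hz)
  then obtain \<gamma> \<delta>2 where \<gamma>: "\<gamma> > 0" "\<delta>2 > 0"
      "\<And>k i. i \<le> J k \<Longrightarrow> prox_step h c (x k) (\<mu> k i) (d k i) \<Longrightarrow>
        x k \<in> cball xbar \<delta>2 \<Longrightarrow> d k i \<in> cball 0 \<delta>2 \<Longrightarrow>
        \<bar>h (linearization c (x k) (d k i)) - h (c xbar)\<bar> < ereal \<delta>2 \<Longrightarrow>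
          norm (p k i - (x k + d k i)) \<le> \<gamma> * (norm (d k i))\<^sup>2 \<and>
          h (c (p k i)) \<le> h (linearization c (x k) (d k i)) + ereal (\<gamma> * (norm (d k i))\<^sup>2)"
    using assms(7) C2 lsc trans unfolding efficient_projection_def by meson
  define \<epsilon> where "\<epsilon> = min \<delta>2 (1 / (2 * \<gamma>))"
  have \<epsilon>: "\<epsilon> > 0" using \<gamma>(1,2) by (simp add: \<epsilon>_def)
  obtain \<delta>3 M3 where \<delta>3: "\<delta>3 > 0"
      "\<And>x \<mu> d. dist x xbar < \<delta>3 \<Longrightarrow> \<mu> \<ge> M3 \<Longrightarrow> h (c x) < ereal (hz + \<delta>3) \<Longrightarrow>
        prox_lin h c x \<mu> d \<le> h (c x) \<Longrightarrow>
        norm d < \<epsilon> \<and> \<bar>h (linearization c x d) - ereal hz\<bar> < ereal \<epsilon>"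
    using prox_lin_decrease_near[OF C2 hz lsc pb \<epsilon>] by metis
  obtain \<delta>4 M4 where \<delta>4: "\<delta>4 > 0"
      "\<And>x \<mu>. dist x xbar < \<delta>4 \<Longrightarrow> \<mu> \<ge> M4 \<Longrightarrow> h (c x) < ereal (hz + \<delta>4) \<Longrightarrow>
        \<not> local_minimizer (prox_lin h c x \<mu>) 0 \<Longrightarrow> \<exists>d. prox_step h c x \<mu> d"
    using prox_step_exists_near[OF C2 hz lsc pb] by metis
  define \<Delta> where "\<Delta> = min (min \<delta>1 \<delta>2) (min \<delta>3 \<delta>4)"
  define Mhat where "Mhat = max M3 (max M4 (2 * \<gamma> / (1 - \<sigma>)))"
  have \<Delta>: "\<Delta> > 0" "\<Delta> \<le> \<delta>1" "\<Delta> \<le> \<delta>2" "\<Delta> \<le> \<delta>3" "\<Delta> \<le> \<delta>4"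
    using \<kappa>(2) \<gamma>(2) \<delta>3(1) \<delta>4(1) by (auto simp: \<Delta>_def)

  have rejected: "\<mu> k i < Mhat" if i: "i < J k" and xk: "dist (x k) xbar < \<Delta>" and Hk: "H k < hz + \<Delta>" for k i
  proof (rule ccontr)
    assume "\<not> \<mu> k i < Mhat"
    then have big: "\<mu> k i \<ge> M3" "\<mu> k i \<ge> M4" "\<mu> k i \<ge> 2 * \<gamma> / (1 - \<sigma>)"
      by (auto simp: Mhat_def)
    have inner: "\<not> local_minimizer (prox_lin h c (x k) (\<mu> k i)) 0"
        "(\<nexists>d'. prox_step h c (x k) (\<mu> k i) d') \<or>
         (prox_step h c (x k) (\<mu> k i) (d k i) \<and> \<not> acceptable h c \<sigma> (x k) (d k i) (p k i))"
      using run i unfolding ProxDescent_run_def by auto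
    have "\<exists>d. prox_step h c (x k) (\<mu> k i) d"
      using \<delta>4(2)[of "x k" "\<mu> k i"] xk Hk big(2) inner(1) \<Delta>(5) by (simp add: HL(1))
    then have ps: "prox_step h c (x k) (\<mu> k i) (d k i)"
        and na: "\<not> acceptable h c \<sigma> (x k) (d k i) (p k i)"
      using inner(2) by auto
    obtain l where l: "h (linearization c (x k) (d k i)) = ereal l"
        "l + \<mu> k i / 2 * (norm (d k i))\<^sup>2 < H k"
      using prox_step_finite[OF ps pb linearization_zero[OF assms(5)] HL(1)] by blast
    have small: "norm (d k i) < \<epsilon>" "\<bar>h (linearization c (x k) (d k i)) - ereal hz\<bar> < ereal \<epsilon>"
      using \<delta>3(2)[of "x k" "\<mu> k i" "d k i"] xk Hk big(1) \<Delta>(4) l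
      by (simp_all add: HL(1) prox_lin_def)
    have "norm (p k i - (x k + d k i)) \<le> \<gamma> * (norm (d k i))\<^sup>2 \<and>
          h (c (p k i)) \<le> h (linearization c (x k) (d k i)) + ereal (\<gamma> * (norm (d k i))\<^sup>2)"
      using small xk \<Delta>(3) i l(1)
      by (intro \<gamma>(3) ps) (auto simp: \<epsilon>_def hz dist_commute)
    moreover have "\<gamma> * norm (d k i) \<le> 1 / 2"
      using small(1) \<gamma>(1) by (simp add: \<epsilon>_def field_simps)
    ultimately have "acceptable h c \<sigma> (x k) (d k i) (p k i)"
      using acceptable_if_large_mu[OF HL(1) l] assms(3) big(3) pb by blast
    then show False using na by simp
  qed

  have "\<forall>\<^sub>F k in sequentially. norm (D k) < \<Delta>"
    using tendstoD[OF Dlim \<Delta>(1)] by simp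
  moreover have "\<forall>\<^sub>F k in sequentially. \<bar>L k - hz\<bar> < \<Delta>"
    using tendstoD[OF Llim \<Delta>(1)] by (simp add: dist_real_def)
  moreover have "\<forall>\<^sub>F k in sequentially. H k < hz + \<Delta>"
    using order_tendstoD(2)[OF Hlim, of "hz + \<Delta>"] \<Delta>(1) by simp
  ultimately have "\<forall>\<^sub>F k in sequentially. norm (D k) < \<Delta> \<and> \<bar>L k - hz\<bar> < \<Delta> \<and> H k < hz + \<Delta>"
    by eventually_elim simp
  then obtain K0 where K0: "\<And>k. k \<ge> K0 \<Longrightarrow> norm (D k) < \<Delta> \<and> \<bar>L k - hz\<bar> < \<Delta> \<and> H k < hz + \<Delta>"
    by (auto simp: eventually_sequentially)
  have lower: "\<kappa> \<le> M k * norm (D k)" if "k \<ge> K0" "dist (x k) xbar < \<Delta>" for k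
  proof (rule \<kappa>(3))
    show "local_minimizer (prox_lin h c (x k) (M k)) (D k)"
      using run unfolding ProxDescent_run_def prox_step_def M_def D_def by simp
    show "h (linearization c (x k) (D k)) = ereal (L k)" using HL(2) by (simp add: D_def)
  qed (use K0[OF that(1)] that(2) \<Delta>(2) M0[of k] in auto)
  define C where "C = 3 / (\<sigma> * \<kappa>)"
  have C: "C > 0" using assms(2) \<kappa>(1) by (simp add: C_def)
  have length: "dist (x (Suc k)) (x k) \<le> C * (H k - H (Suc k))" if "k \<ge> K0" "dist (x k) xbar < \<Delta>" for k
  proof -
    have "\<kappa> * norm (D k) \<le> M k * norm (D k) * norm (D k)"
      using lower[OF that] by (intro mult_right_mono) auto
    then have "\<kappa> / 2 * norm (D k) \<le> H k - L k"
      using dec[of k] by (simp add: power2_eq_square)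
    then have "\<sigma> * (\<kappa> / 2 * norm (D k)) \<le> \<sigma> * (H k - L k)"
      using assms(2) by (intro mult_left_mono) auto
    also have "\<dots> \<le> H k - H (Suc k)" using HL(4) .
    finally have "3 / 2 * norm (D k) \<le> C * (H k - H (Suc k))"
      using assms(2) \<kappa>(1) by (simp add: C_def field_simps)
    then show ?thesis using xstep[of k] by simp
  qed

  have "\<forall>\<^sub>F j in sequentially. dist (x (r j)) xbar < \<Delta> / 2"
    using tendstoD[OF r(2), of "\<Delta> / 2"] \<Delta>(1) by simp
  moreover have "\<forall>\<^sub>F j in sequentially. H (r j) < hz + \<Delta> / (2 * C)"
    using order_tendstoD(2)[OF Hr, of "hz + \<Delta> / (2 * C)"] \<Delta>(1) C by simp
  moreover have "\<forall>\<^sub>F j in sequentially. K0 \<le> r j"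
    using seq_suble[OF r(1)] by (intro eventually_sequentiallyI[of K0]) (meson order.trans)
  ultimately have "\<forall>\<^sub>F j in sequentially. dist (x (r j)) xbar < \<Delta> / 2 \<and> H (r j) < hz + \<Delta> / (2 * C) \<and> K0 \<le> r j"
    by eventually_elim simp
  then obtain K1 where K1: "dist (x K1) xbar < \<Delta> / 2" "H K1 < hz + \<Delta> / (2 * C)" "K0 \<le> K1"
    by (auto simp: eventually_sequentially)
  have "C * (H K1 - hz) < \<Delta> / 2" using K1(2) C by (simp add: field_simps)
  then have inball: "dist (x k) xbar < \<Delta>" if "dist (x k) xbar \<le> dist (x K1) xbar + C * (H K1 - H k)" for k
  proof -
    have "C * (H K1 - H k) \<le> C * (H K1 - hz)"
      using Hge[of k] C by (intro mult_left_mono) auto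
    with \<open>C * (H K1 - hz) < \<Delta> / 2\<close> that K1(1) show ?thesis by linarith
  qed
  have "dist (x k) xbar \<le> dist (x K1) xbar + C * (H K1 - H k)" if "k \<ge> K1" for k
    using that
  proof (induction k rule: dec_induct)
    case (step k)
    have "dist (x (Suc k)) xbar \<le> dist (x (Suc k)) (x k) + dist (x k) xbar"
      by (rule dist_triangle)
    also have "\<dots> \<le> C * (H k - H (Suc k)) + (dist (x K1) xbar + C * (H K1 - H k))"
      using step.IH length[OF _ inball[OF step.IH]] step.hyps K1(3) by (intro add_mono) auto
    finally show ?case by (simp add: algebra_simps)
  qed simp
  then have trapped: "dist (x k) xbar < \<Delta>" if "k \<ge> K1" for k
    using inball that by blast

  define B where "B = max (M K1) (max (\<tau> * Mhat) \<mu>min)"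
  have bounded: "M k \<le> B" if "k \<ge> K1" for k
    using that
  proof (induction k rule: dec_induct)
    case base
    then show ?case by (simp add: B_def)
  next
    case (step k)
    show ?case
    proof (cases "J (Suc k)")
      case 0
      then have "M (Suc k) = max \<mu>min (M k / \<tau>)"
        using run unfolding ProxDescent_run_def M_def by simp
      moreover have "M k / \<tau> \<le> M k"
        using M0[of k] assms(1) by (simp add: field_simps)
      ultimately show ?thesis using step.IH by (simp add: B_def)
    next
      case (Suc i)
      then have "M (Suc k) = \<tau> * \<mu> (Suc k) i"
        using run unfolding ProxDescent_run_def M_def by simp
      also have "\<dots> \<le> \<tau> * Mhat"
        using rejected[of i "Suc k"] trapped[of "Suc k"] K0[of "Suc k"] K1(3) step.hyps Suc assms(1)
        by (intro mult_left_mono) auto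
      finally show ?thesis by (simp add: B_def)
    qed
  qed
  have "\<kappa> \<le> B * norm (D k)" if "k \<ge> K1" for k
    using lower[OF _ trapped[OF that]] K1(3) that mult_right_mono[OF bounded[OF that], of "norm (D k)"]
    by simp
  then have "\<forall>\<^sub>F k in sequentially. \<kappa> \<le> B * norm (D k)"
    by (rule eventually_sequentiallyI)
  moreover have "(\<lambda>k. B * norm (D k)) \<longlonglongrightarrow> B * norm (0 :: real ^ 'n)"
    by (intro tendsto_intros Dlim)
  ultimately have "\<kappa> \<le> B * norm (0 :: real ^ 'n)"
    by (intro tendsto_lowerbound) auto
  then show False using \<kappa>(1) by simp
qed

end
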